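(* Let $\mathcal S$ be any setup, with price sets $\mathcal P_1,\dots,\mathcal P_n$ and starting inventories $k_1,\dots,k_n$. Then, for suitably chosen randomized initialization procedures, \textsc{Multi-price Balance} achieves a competitive ratio of $\min_{i\in[n]}\tilde F_i$ on $\mathcal S$, for some numbers $\tilde F_1,\dots,\tilde F_n$ such that for each item $i$: (i) $\tilde F_i\ge \frac{F(\mathcal P_i)}{(1+k_i)(e^{1/k_i}-1)}$; (ii) $\tilde F_i\ge \frac{G(\mathcal P_i)}{2}$; and (iii) if $|\mathcal P_i|=1$, then $\tilde F_i\ge \frac{1-1/e}{(1+k_i)(1-e^{-1/k_i})}$.
   Context: Problem. A setup $\mathcal S$ consists of $n\in\mathbb N$ items; item $i\in[n]$ has starting inventory $k_i\in\mathbb N$ and a price set $\mathcal P_i=\{r_i^{(1)},\dots,r_i^{(m_i)}\}$ with $m_i\in\mathbb N$ and $0<r_i^{(1)}<\dots<r_i^{(m_i)}$; set $r_i^{(0)}=0$. An arrival sequence $\mathcal A$ consists of $T\in\mathbb N$ customers and numbers $p^{(j)}_{t,i}\in[0,1]$ ($t\in[T],i\in[n],j\in[m_i]$). Customers arrive in order $t=1,\dots,T$; on arrival of $t$ the numbers $p^{(j)}_{t,i}$ are revealed, and the firm either offers nothing or offers one item $i$ with remaining inventory at one price index $j\in[m_i]$; the customer accepts with probability $p^{(j)}_{t,i}$, independently of everything else, in which case the firm earns $r_i^{(j)}$ and the inventory of $i$ drops by one. An online algorithm makes each (possibly randomized) decision using only $\mathcal S$, past customers' probabilities and outcomes, and the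 current customer's probabilities; $\mathsf{ALG}(\mathcal S,\mathcal A)$ is its random revenue. $\mathsf{OPT}(\mathcal S,\mathcal A)$ is the optimal value of the LP: maximize $\sum_{t,i,j}p^{(j)}_{t,i}r^{(j)}_ix^{(j)}_{t,i}$ subject to $\sum_{t}\sum_{j}p^{(j)}_{t,i}x^{(j)}_{t,i}\le k_i$ for all $i$, $\sum_i\sum_j x^{(j)}_{t,i}\le1$ for all $t$, $x\ge0$. An online algorithm achieves competitive ratio $c$ on $\mathcal S$ if $\mathbb E[\mathsf{ALG}(\mathcal S,\mathcal A)]\ge c\cdot\mathsf{OPT}(\mathcal S,\mathcal A)$ for all arrival sequences $\mathcal A$. Price-set quantities. For a price set $\mathcal P=\{r^{(1)}<\dots<r^{(m)}\}$ of positive numbers, let $\alpha^{(1)},\dots,\alpha^{(m)}$ be the unique positive numbers summing to $1$ with $1-e^{-\alpha^{(1)}}=\frac{1-e^{-\alpha^{(j)}}}{1-r^{(j-1)}/r^{(j)}}$ for $j=2,\dots,m$, and $\sigma^{(1)},\dots,\sigma^{(m)}$ the unique positive numbers summing to $1$ with $\sigma^{(1)}=\frac{\sigma^{(j)}}{1-r^{(j-1)}/r^{(j)}}$ for $j=2,\dots,m$. Define $F(\mathcal P)=1-e^{-\alpha^{(1)}}$ and $G(\mathcal P)=\sigma^{(1)}$. \textsc{Multi-price Balance}. At the start, independently for each item $i$, a randomized initialization procedure (a parameter of the algorithm) produces random segment borders $\tilde L_i^{(0)},\dots,\tilde L_i^{(m_i)}\in\{0,\frac1{k_i},\dots,1\}$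 with $0=\tilde L_i^{(0)}\le\dots\le\tilde L_i^{(m_i)}=1$ and a random function $\tilde\Phi_i$ on $\{0,\frac1{k_i},\dots,1\}$ with $0=\tilde\Phi_i(0)\le\tilde\Phi_i(\frac1{k_i})\le\dots\le\tilde\Phi_i(1)$. Let $N_i$ be the number of units of item $i$ sold so far (initially $0$). For each customer $t$, compute $\max_{i\in[n],j\in[m_i]}p^{(j)}_{t,i}\big(\tilde\Phi_i(\tilde L_i^{(j)})-\tilde\Phi_i(N_i/k_i)\big)$; if it is strictly positive, offer a maximizing item $i$ at price $r_i^{(j)}$ for a maximizing $j$ (if accepted, $N_i$ increases by one); otherwise offer nothing. The algorithm may also be run after replacing an item $i$ with $k_i$ units by $k_i$ separate items, each with one unit and price set $\mathcal P_i$. *)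

theory Defs
  imports "HOL-Probability.Probability"
begin

section \<open>Setups, arrival sequences and the LP benchmark\<close>

text \<open>
  The items form an arbitrary finite nonempty set. The price indices of an item with price set
  \<open>P\<close> are \<open>1, ..., card P\<close>, and \<open>price P j\<close> is the j-th smallest price, with \<open>price P 0 = 0\<close>.
\<close>

record 'i sales_setup =
  items :: "'i set"
  inv_of :: "'i \<Rightarrow> nat"
  prices :: "'i \<Rightarrow> real set"

definition price_set :: "real set \<Rightarrow> bool" where
  "price_set P \<longleftrightarrow> finite P \<and> P \<noteq> {} \<and> (\<forall>r\<in>P. 0 < r)"

definition price :: "real set \<Rightarrow> nat \<Rightarrow> real" where
  "price P j = (0 # sorted_list_of_set P) ! j"

abbreviation price_indices :: "'i sales_setup \<Rightarrow> 'i \<Rightarrow> nat set" where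
  "price_indices S i \<equiv> {1..card (prices S i)}"

definition valid_setup :: "'i sales_setup \<Rightarrow> bool" where
  "valid_setup S \<longleftrightarrow> finite (items S) \<and> items S \<noteq> {} \<and>
     (\<forall>i\<in>items S. 1 \<le> inv_of S i \<and> price_set (prices S i))"

text \<open>A customer is given by the acceptance probabilities, indexed by item and price index.\<close>

type_synonym 'i customer = "'i \<Rightarrow> nat \<Rightarrow> real"

definition arrival_sequence :: "'i sales_setup \<Rightarrow> 'i customer list \<Rightarrow> bool" where
  "arrival_sequence S A \<longleftrightarrow>
     (\<forall>p\<in>set A. \<forall>i\<in>items S. \<forall>j\<in>price_indices S i. 0 \<le> p i j \<and> p i j \<le> 1)"

definition LP_feasible :: "'i sales_setup \<Rightarrow> 'i customer list \<Rightarrow> (nat \<Rightarrow> 'i \<Rightarrow> nat \<Rightarrow> real) \<Rightarrow> bool" where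
  "LP_feasible S A x \<longleftrightarrow>
     (\<forall>i\<in>items S. (\<Sum>t<length A. \<Sum>j\<in>price_indices S i. (A ! t) i j * x t i j) \<le> real (inv_of S i)) \<and>
     (\<forall>t<length A. (\<Sum>i\<in>items S. \<Sum>j\<in>price_indices S i. x t i j) \<le> 1) \<and>
     (\<forall>t<length A. \<forall>i\<in>items S. \<forall>j\<in>price_indices S i. 0 \<le> x t i j)"

definition LP_value :: "'i sales_setup \<Rightarrow> 'i customer list \<Rightarrow> (nat \<Rightarrow> 'i \<Rightarrow> nat \<Rightarrow> real) \<Rightarrow> real" where
  "LP_value S A x =
     (\<Sum>t<length A. \<Sum>i\<in>items S. \<Sum>j\<in>price_indices S i.
        (A ! t) i j * price (prices S i) j * x t i j)"

definition OPT :: "'i sales_setup \<Rightarrow> 'i customer list \<Rightarrow> real" where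
  "OPT S A = (SUP x\<in>{x. LP_feasible S A x}. LP_value S A x)"

text \<open>
  An online algorithm enters only through its revenue distribution on each arrival sequence.
\<close>

definition achieves_competitive_ratio ::
    "'i sales_setup \<Rightarrow> ('i customer list \<Rightarrow> real pmf) \<Rightarrow> real \<Rightarrow> bool" where
  "achieves_competitive_ratio S ALG c \<longleftrightarrow>
     (\<forall>A. arrival_sequence S A \<longrightarrow>
        c * OPT S A \<le> measure_pmf.expectation (ALG A) (\<lambda>v. v))"


section \<open>The price-set quantities\<close>

definition alpha_system :: "real set \<Rightarrow> (nat \<Rightarrow> real) \<Rightarrow> bool" where
  "alpha_system P \<alpha> \<longleftrightarrow>
     (\<forall>j\<in>{1..card P}. 0 < \<alpha> j) \<and> (\<Sum>j = 1..card P. \<alpha> j) = 1 \<and>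
     (\<forall>j\<in>{2..card P}.
        1 - exp (- \<alpha> 1) = (1 - exp (- \<alpha> j)) / (1 - price P (j - 1) / price P j))"

definition sigma_system :: "real set \<Rightarrow> (nat \<Rightarrow> real) \<Rightarrow> bool" where
  "sigma_system P \<sigma> \<longleftrightarrow>
     (\<forall>j\<in>{1..card P}. 0 < \<sigma> j) \<and> (\<Sum>j = 1..card P. \<sigma> j) = 1 \<and>
     (\<forall>j\<in>{2..card P}. \<sigma> 1 = \<sigma> j / (1 - price P (j - 1) / price P j))"

text \<open>The solutions are made unique as functions on \<open>nat\<close> by the value 0 outside \<open>{1..card P}\<close>.\<close>

definition alphas :: "real set \<Rightarrow> nat \<Rightarrow> real" where
  "alphas P = (THE \<alpha>. alpha_system P \<alpha> \<and> (\<forall>j. j \<notin> {1..card P} \<longrightarrow> \<alpha> j = 0))"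

definition sigmas :: "real set \<Rightarrow> nat \<Rightarrow> real" where
  "sigmas P = (THE \<sigma>. sigma_system P \<sigma> \<and> (\<forall>j. j \<notin> {1..card P} \<longrightarrow> \<sigma> j = 0))"

definition F_val :: "real set \<Rightarrow> real" where
  "F_val P = 1 - exp (- alphas P 1)"

definition G_val :: "real set \<Rightarrow> real" where
  "G_val P = sigmas P 1"


section \<open>Online processes\<close>

text \<open>
  \<open>Some (i, j)\<close> offers item \<open>i\<close> at its j-th price, \<open>None\<close> offers nothing. A history records, in order
  of arrival, each past customer, the offer made, and whether it was accepted. A (randomized)
  decision rule sees only the history and the current customer.
\<close>

type_synonym 'i offer = "('i \<times> nat) option"
type_synonym 'i history = "('i customer \<times> 'i offer \<times> bool) list"
type_synonym 'i decision = "'i history \<Rightarrow> 'i customer \<Rightarrow> 'i offer pmf"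

definition response :: "'i customer \<Rightarrow> 'i offer \<Rightarrow> bool pmf" where
  "response p a = (case a of None \<Rightarrow> return_pmf False | Some (i, j) \<Rightarrow> bernoulli_pmf (p i j))"

primrec run :: "'i decision \<Rightarrow> 'i history \<Rightarrow> 'i customer list \<Rightarrow> 'i history pmf" where
  "run d h [] = return_pmf h"
| "run d h (p # ps) =
     bind_pmf (d h p) (\<lambda>a. bind_pmf (response p a) (\<lambda>b. run d (h @ [(p, a, b)]) ps))"

definition units_sold :: "'i history \<Rightarrow> 'i \<Rightarrow> nat" where
  "units_sold h i = length (filter (\<lambda>(p, a, b). b \<and> map_option fst a = Some i) h)"

definition revenue :: "'i sales_setup \<Rightarrow> 'i history \<Rightarrow> real" where
  "revenue S h = (\<Sum>(p, a, b)\<leftarrow>h.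
     (case a of Some (i, j) \<Rightarrow> if b then price (prices S i) j else 0 | None \<Rightarrow> 0))"


section \<open>Multi-price Balance\<close>

text \<open>An initialization of one item: the segment borders and the value function.\<close>

type_synonym init = "(nat \<Rightarrow> real) \<times> (real \<Rightarrow> real)"

definition valid_init :: "nat \<Rightarrow> nat \<Rightarrow> init \<Rightarrow> bool" where
  "valid_init k m = (\<lambda>(L, \<Phi>).
     (\<forall>j\<le>m. L j \<in> {real a / real k | a. a \<le> k}) \<and>
     L 0 = 0 \<and> L m = 1 \<and> (\<forall>j<m. L j \<le> L (Suc j)) \<and>
     \<Phi> 0 = 0 \<and> (\<forall>a<k. \<Phi> (real a / real k) \<le> \<Phi> (real (Suc a) / real k)))"

definition init_procedures :: "'i sales_setup \<Rightarrow> ('i \<Rightarrow> init pmf) \<Rightarrow> bool" where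
  "init_procedures S D \<longleftrightarrow>
     (\<forall>i\<in>items S. \<forall>\<omega>\<in>set_pmf (D i). valid_init (inv_of S i) (card (prices S i)) \<omega>)"

definition score :: "'i sales_setup \<Rightarrow> ('i \<Rightarrow> init) \<Rightarrow> 'i history \<Rightarrow> 'i customer \<Rightarrow> 'i \<times> nat \<Rightarrow> real" where
  "score S \<omega> h p = (\<lambda>(i, j). case \<omega> i of (L, \<Phi>) \<Rightarrow>
     p i j * (\<Phi> (L j) - \<Phi> (real (units_sold h i) / real (inv_of S i))))"

definition max_score :: "'i sales_setup \<Rightarrow> ('i \<Rightarrow> init) \<Rightarrow> 'i history \<Rightarrow> 'i customer \<Rightarrow> real" where
  "max_score S \<omega> h p = Max (score S \<omega> h p ` Sigma (items S) (price_indices S))"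

definition MPB_offers :: "'i sales_setup \<Rightarrow> ('i \<Rightarrow> init) \<Rightarrow> 'i history \<Rightarrow> 'i customer \<Rightarrow> 'i offer set" where
  "MPB_offers S \<omega> h p =
     (if 0 < max_score S \<omega> h p
      then {Some (i, j) | i j. i \<in> items S \<and> j \<in> price_indices S i \<and>
              score S \<omega> h p (i, j) = max_score S \<omega> h p}
      else {None})"

text \<open>
  Since ties between maximizers may be broken in any way, Multi-price Balance is a class of
  decision rules: those whose offers are always among \<open>MPB_offers\<close>. Ties may be broken at random,
  depending on the initialization and the history.
\<close>

definition MPB_rule :: "'i sales_setup \<Rightarrow> (('i \<Rightarrow> init) \<Rightarrow> 'i decision) \<Rightarrow> bool" where
  "MPB_rule S d \<longleftrightarrow> (\<forall>\<omega> h p. set_pmf (d \<omega> h p) \<subseteq> MPB_offers S \<omega> h p)"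

definition MPB_revenue ::
    "'i sales_setup \<Rightarrow> ('i \<Rightarrow> init pmf) \<Rightarrow> (('i \<Rightarrow> init) \<Rightarrow> 'i decision) \<Rightarrow> 'i customer list \<Rightarrow> real pmf" where
  "MPB_revenue S D d A =
     bind_pmf (Pi_pmf (items S) undefined D) (\<lambda>\<omega>. map_pmf (revenue S) (run (d \<omega>) [] A))"


section \<open>Splitting items into single units\<close>

text \<open>
  Each item \<open>i \<in> Q\<close> is replaced by single-unit items \<open>(i, 0), ..., (i, k - 1)\<close>, where \<open>k\<close> is its
  inventory; every other item \<open>i\<close> is kept, under the name \<open>(i, 0)\<close>.
\<close>

definition split_setup :: "'i set \<Rightarrow> 'i sales_setup \<Rightarrow> ('i \<times> nat) sales_setup" where
  "split_setup Q S =
     \<lparr> items = Sigma (items S) (\<lambda>i. if i \<in> Q then {..<inv_of S i} else {0}),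
       inv_of = (\<lambda>(i, l). if i \<in> Q then 1 else inv_of S i),
       prices = (\<lambda>(i, l). prices S i) \<rparr>"

definition split_customer :: "'i customer \<Rightarrow> ('i \<times> nat) customer" where
  "split_customer p = (\<lambda>(i, l) j. p i j)"


section \<open>Well-definedness\<close>

lemma price_props:
  assumes "price_set P"
  shows "price P 0 = 0"
    and "\<lbrakk>j \<in> {1..card P}\<rbrakk> \<Longrightarrow> 0 < price P j \<and> price P (j - 1) < price P j"
proof -
  show "price P 0 = 0" by (simp add: price_def)
next
  assume j: "j \<in> {1..card P}"
  have fin: "finite P" and pos: "\<forall>r\<in>P. 0 < r" using assms by (auto simp: price_set_def)
  let ?xs = "0 # sorted_list_of_set P"
  have srt: "sorted_wrt (<) ?xs" using pos fin by simp
  have "length ?xs = Suc (card P)" by simp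
  then have lt: "?xs ! a < ?xs ! b" if "a < b" "b \<le> card P" for a b
    using sorted_wrt_nth_less[OF srt, of a b] that by simp
  show "0 < price P j \<and> price P (j - 1) < price P j"
    using lt[of 0 j] lt[of "j - 1" j] j by (auto simp: price_def)
qed

definition price_weight :: "real set \<Rightarrow> nat \<Rightarrow> real" where
  "price_weight P j = 1 - price P (j - 1) / price P j"

lemma price_weight_props:
  assumes "price_set P"
  shows "price_weight P 1 = 1"
    and "j \<in> {1..card P} \<Longrightarrow> 0 < price_weight P j \<and> price_weight P j \<le> 1"
proof -
  show "price_weight P 1 = 1" by (simp add: price_weight_def price_props[OF assms])
next
  assume j: "j \<in> {1..card P}"
  have "0 \<le> price P (j - 1)"
  proof (cases "j = 1")
    case True then show ?thesis by (simp add: price_props[OF assms])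
  next
    case False
    then have "j - 1 \<in> {1..card P}" using j by auto
    from price_props(2)[OF assms this] show ?thesis by simp
  qed
  with price_props(2)[OF assms j] show "0 < price_weight P j \<and> price_weight P j \<le> 1"
    by (simp add: price_weight_def field_simps)
qed

lemma card_price_set: "price_set P \<Longrightarrow> 1 \<le> card P"
  by (metis One_nat_def Suc_leI card_gt_0_iff price_set_def)

lemma sigma_system_unique_solution:
  assumes P: "price_set P"
  shows "\<exists>!\<sigma>. sigma_system P \<sigma> \<and> (\<forall>j. j \<notin> {1..card P} \<longrightarrow> \<sigma> j = 0)"
proof -
  let ?w = "price_weight P" and ?m = "card P"
  have w: "0 < ?w j" if "j \<in> {1..?m}" for j using price_weight_props(2)[OF P that] by simp
  have m: "1 \<le> ?m" by (rule card_price_set[OF P])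
  define W where "W = (\<Sum>j=1..?m. ?w j)"
  have Wpos: "0 < W" unfolding W_def using w m by (intro sum_pos) auto
  have eq: "sigma_system P \<sigma> \<longleftrightarrow>
      (\<forall>j\<in>{1..?m}. 0 < \<sigma> j) \<and> (\<Sum>j=1..?m. \<sigma> j) = 1 \<and> (\<forall>j\<in>{1..?m}. \<sigma> j = \<sigma> 1 * ?w j)" for \<sigma>
  proof -
    have "(\<forall>j\<in>{2..?m}. \<sigma> 1 = \<sigma> j / ?w j) \<longleftrightarrow> (\<forall>j\<in>{1..?m}. \<sigma> j = \<sigma> 1 * ?w j)"
    proof -
      have *: "{1..?m} = insert 1 {2..?m}" using m by auto
      have "\<forall>j\<in>{2..?m}. ?w j \<noteq> 0"
      proof
        fix j assume "j \<in> {2..?m}"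
        then have "0 < ?w j" by (intro w) auto
        then show "?w j \<noteq> 0" by simp
      qed
      then have **: "(x = y / ?w j) = (y = x * ?w j)" if "j \<in> {2..?m}" for x y j
        using that by (auto simp: nonzero_eq_divide_eq)
      have "(\<forall>j\<in>{2..?m}. \<sigma> 1 = \<sigma> j / ?w j) \<longleftrightarrow> (\<forall>j\<in>{2..?m}. \<sigma> j = \<sigma> 1 * ?w j)"
        by (intro ball_cong refl **)
      then show ?thesis unfolding * using price_weight_props(1)[OF P] by simp
    qed
    then show ?thesis by (simp add: sigma_system_def price_weight_def)
  qed
  show ?thesis
  proof (rule ex1I[where a = "\<lambda>j. if j \<in> {1..?m} then ?w j / W else 0"])
    have "(\<Sum>j=1..?m. ?w j / W) = 1" using Wpos
      by (simp add: W_def flip: sum_divide_distrib)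
    then show "sigma_system P (\<lambda>j. if j \<in> {1..?m} then ?w j / W else 0) \<and>
      (\<forall>j. j \<notin> {1..?m} \<longrightarrow> (if j \<in> {1..?m} then ?w j / W else 0) = 0)"
      unfolding eq using w Wpos m price_weight_props(1)[OF P] by simp
  next
    fix \<sigma> assume a: "sigma_system P \<sigma> \<and> (\<forall>j. j \<notin> {1..?m} \<longrightarrow> \<sigma> j = 0)"
    then have s: "(\<Sum>j=1..?m. \<sigma> j) = 1" and j: "\<forall>j\<in>{1..?m}. \<sigma> j = \<sigma> 1 * ?w j"
      unfolding eq by blast+
    have "(\<Sum>j=1..?m. \<sigma> j) = (\<Sum>j=1..?m. \<sigma> 1 * ?w j)"
      by (rule sum.cong[OF refl]) (use j in blast)
    also have "\<dots> = \<sigma> 1 * W" by (simp add: W_def sum_distrib_left)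
    finally have "\<sigma> 1 = 1 / W" using s Wpos by (simp add: field_simps)
    show "\<sigma> = (\<lambda>j. if j \<in> {1..?m} then ?w j / W else 0)"
    proof
      fix i
      show "\<sigma> i = (if i \<in> {1..?m} then ?w i / W else 0)"
      proof (cases "i \<in> {1..?m}")
        case True
        then have "\<sigma> i = \<sigma> 1 * ?w i" using j by blast
        then show ?thesis using True \<open>\<sigma> 1 = 1 / W\<close> by simp
      next
        case False then show ?thesis using a by auto
      qed
    qed
  qed
qed

lemma alpha_system_unique_solution:
  assumes P: "price_set P"
  shows "\<exists>!\<alpha>. alpha_system P \<alpha> \<and> (\<forall>j. j \<notin> {1..card P} \<longrightarrow> \<alpha> j = 0)"
proof -
  let ?w = "price_weight P" and ?m = "card P"
  have w: "0 < ?w j" "?w j \<le> 1" if "j \<in> {1..?m}" for j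
    using price_weight_props(2)[OF P that] by simp_all
  have m: "1 \<le> ?m" by (rule card_price_set[OF P])
  have w1: "?w 1 = 1" by (rule price_weight_props(1)[OF P])
  define A where "A c j = - ln (1 - c * ?w j)" for c j
  define H where "H c = (\<Sum>j=1..?m. A c j)" for c
  have cw: "c * ?w j < 1" if "0 \<le> c" "c < 1" "j \<in> {1..?m}" for c j
  proof -
    have "c * ?w j \<le> c * 1" using w[OF that(3)] that by (intro mult_left_mono) auto
    then show ?thesis using that by simp
  qed
  have Aless: "A c j < A c' j" if "0 \<le> c" "c < c'" "c' < 1" "j \<in> {1..?m}" for c c' j
  proof -
    have "c * ?w j < c' * ?w j" using w[OF that(4)] that by simp
    then show ?thesis using cw[of c' j] that by (simp add: A_def)
  qed
  have Hless: "H c < H c'" if "0 \<le> c" "c < c'" "c' < 1" for c c'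
    unfolding H_def using Aless[OF that] m by (intro sum_strict_mono) auto
  have H0: "H 0 = 0" by (simp add: H_def A_def)
  define e where "e = 1 - exp (-1::real)"
  have e: "0 < e" "e < 1" by (auto simp: e_def)
  have He: "1 \<le> H e"
  proof -
    have "1 = A e 1" using w1 by (simp add: A_def e_def)
    also have "\<dots> \<le> (\<Sum>j=1..?m. A e j)"
    proof (rule member_le_sum)
      fix x assume "x \<in> {1..?m} - {1}"
      then have "A 0 x < A e x" using e by (intro Aless) auto
      then show "0 \<le> A e x" by (simp add: A_def)
    qed (use m in auto)
    finally show ?thesis by (simp add: H_def)
  qed
  have "continuous_on {0..e} H" unfolding H_def A_def
    by (intro continuous_intros ballI) (use cw e in force)
  then obtain c where c: "0 \<le> c" "c \<le> e" "H c = 1"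
    using IVT'[of H 0 1 e] H0 He e by auto
  have c1: "c < 1" using c e by simp
  have c0: "0 < c" using c H0 by (cases "c = 0") auto
  have eq: "alpha_system P \<alpha> \<longleftrightarrow>
      (\<forall>j\<in>{1..?m}. 0 < \<alpha> j) \<and> (\<Sum>j=1..?m. \<alpha> j) = 1 \<and>
      (\<forall>j\<in>{1..?m}. 1 - exp (- \<alpha> j) = (1 - exp (- \<alpha> 1)) * ?w j)" for \<alpha>
  proof -
    have "(\<forall>j\<in>{2..?m}. 1 - exp (- \<alpha> 1) = (1 - exp (- \<alpha> j)) / ?w j) \<longleftrightarrow>
        (\<forall>j\<in>{1..?m}. 1 - exp (- \<alpha> j) = (1 - exp (- \<alpha> 1)) * ?w j)"
    proof -
      have *: "{1..?m} = insert 1 {2..?m}" using m by auto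
      have "\<forall>j\<in>{2..?m}. ?w j \<noteq> 0"
      proof
        fix j assume "j \<in> {2..?m}"
        then have "0 < ?w j" by (intro w) auto
        then show "?w j \<noteq> 0" by simp
      qed
      then have **: "(x = y / ?w j) = (y = x * ?w j)" if "j \<in> {2..?m}" for x y j
        using that by (auto simp: nonzero_eq_divide_eq)
      have "(\<forall>j\<in>{2..?m}. 1 - exp (- \<alpha> 1) = (1 - exp (- \<alpha> j)) / ?w j) \<longleftrightarrow>
          (\<forall>j\<in>{2..?m}. 1 - exp (- \<alpha> j) = (1 - exp (- \<alpha> 1)) * ?w j)"
        by (intro ball_cong refl **)
      then show ?thesis unfolding * using w1 by simp
    qed
    then show ?thesis by (simp add: alpha_system_def price_weight_def)
  qed
  have solA: "1 - exp (- A c' j) = c' * ?w j" if "0 \<le> c'" "c' < 1" "j \<in> {1..?m}" for c' j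
    using cw[OF that] by (simp add: A_def)
  have Apos: "0 < A c j" if "j \<in> {1..?m}" for j
    using Aless[of 0 c j] c0 c1 that by (simp add: A_def)
  show ?thesis
  proof (rule ex1I[where a = "\<lambda>j. if j \<in> {1..?m} then A c j else 0"])
    show "alpha_system P (\<lambda>j. if j \<in> {1..?m} then A c j else 0) \<and>
      (\<forall>j. j \<notin> {1..?m} \<longrightarrow> (if j \<in> {1..?m} then A c j else 0) = 0)"
      unfolding eq using Apos c(1) c1 c(3) m solA[of c] w1 by (simp add: H_def)
  next
    fix \<alpha> assume a: "alpha_system P \<alpha> \<and> (\<forall>j. j \<notin> {1..?m} \<longrightarrow> \<alpha> j = 0)"
    then have pos: "\<forall>j\<in>{1..?m}. 0 < \<alpha> j" and s: "(\<Sum>j=1..?m. \<alpha> j) = 1"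
      and j: "\<forall>j\<in>{1..?m}. 1 - exp (- \<alpha> j) = (1 - exp (- \<alpha> 1)) * ?w j"
      unfolding eq by blast+
    define c' where "c' = 1 - exp (- \<alpha> 1)"
    have c': "0 \<le> c'" "c' < 1" using pos m by (auto simp: c'_def less_imp_le)
    have \<alpha>A: "\<alpha> i = A c' i" if "i \<in> {1..?m}" for i
    proof -
      have "1 - exp (- \<alpha> i) = c' * ?w i" using j that unfolding c'_def by blast
      then have "exp (- \<alpha> i) = 1 - c' * ?w i" by linarith
      then have "ln (1 - c' * ?w i) = - \<alpha> i" by (metis ln_exp)
      then show ?thesis by (simp add: A_def)
    qed
    then have "H c' = 1" unfolding H_def s[symmetric] by (intro sum.cong) auto
    then have "c' = c" using Hless[of c c'] Hless[of c' c] c c' c1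
      by (metis less_irrefl linorder_less_linear)
    show "\<alpha> = (\<lambda>j. if j \<in> {1..?m} then A c j else 0)"
    proof
      fix i
      show "\<alpha> i = (if i \<in> {1..?m} then A c i else 0)"
      proof (cases "i \<in> {1..?m}")
        case True then show ?thesis using \<alpha>A \<open>c' = c\<close> by simp
      next
        case False then show ?thesis using a by auto
      qed
    qed
  qed
qed

text \<open>The supremum in \<open>OPT\<close> is over a nonempty set that is bounded above.\<close>

lemma LP_feasible_zero: "LP_feasible S A (\<lambda>t i j. 0)"
  by (simp add: LP_feasible_def)

lemma LP_value_bdd_above:
  assumes S: "valid_setup S" and A: "arrival_sequence S A"
  shows "bdd_above (LP_value S A ` {x. LP_feasible S A x})"
proof (rule bdd_aboveI2)
  fix x assume x: "x \<in> {x. LP_feasible S A x}"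
  have fin: "finite (items S)" using S by (simp add: valid_setup_def)
  show "LP_value S A x \<le>
    (\<Sum>t<length A. \<Sum>i\<in>items S. \<Sum>j\<in>price_indices S i. price (prices S i) j)"
    unfolding LP_value_def
  proof (intro sum_mono)
    fix t i j assume t: "t \<in> {..<length A}" and i: "i \<in> items S" and j: "j \<in> price_indices S i"
    have nn: "0 \<le> x t i' j'" if "i' \<in> items S" "j' \<in> price_indices S i'" for i' j'
      using x t that by (auto simp: LP_feasible_def)
    have "x t i j \<le> (\<Sum>j\<in>price_indices S i. x t i j)"
      using nn i j by (intro member_le_sum) auto
    also have "\<dots> \<le> (\<Sum>i\<in>items S. \<Sum>j\<in>price_indices S i. x t i j)"
      using nn i fin
      by (intro member_le_sum[where f = "\<lambda>i. \<Sum>j\<in>price_indices S i. x t i j"] sum_nonneg) auto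
    also have "\<dots> \<le> 1" using x t by (auto simp: LP_feasible_def)
    finally have x1: "x t i j \<le> 1" .
    have p: "0 \<le> (A ! t) i j" "(A ! t) i j \<le> 1"
      using A t i j nth_mem[of t A] by (auto simp: arrival_sequence_def simp del: nth_mem)
    have "0 < price (prices S i) j"
      using S i j price_props(2) by (auto simp: valid_setup_def)
    then have "(A ! t) i j * x t i j * price (prices S i) j \<le> 1 * price (prices S i) j"
      using p x1 nn[OF i j] by (intro mult_right_mono mult_le_one) auto
    then show "(A ! t) i j * price (prices S i) j * x t i j \<le> price (prices S i) j"
      by (simp add: mult_ac)
  qed
qed

text \<open>A maximizing offer always exists, and items without remaining inventory are never offered.\<close>

lemma MPB_offers_nonempty:
  assumes S: "valid_setup S"
  shows "MPB_offers S \<omega> h p \<noteq> {}"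
proof -
  let ?I = "Sigma (items S) (price_indices S)"
  have "finite ?I" using S by (auto simp: valid_setup_def)
  moreover have "?I \<noteq> {}"
    using S card_price_set by (fastforce simp: valid_setup_def)
  ultimately have "max_score S \<omega> h p \<in> score S \<omega> h p ` ?I"
    unfolding max_score_def by (intro Max_in) auto
  then obtain i j where "i \<in> items S" "j \<in> price_indices S i"
    "score S \<omega> h p (i, j) = max_score S \<omega> h p"
    by auto
  then have "Some (i, j) \<in> MPB_offers S \<omega> h p \<or> None \<in> MPB_offers S \<omega> h p"
    unfolding MPB_offers_def by simp
  then show ?thesis by blast
qed

lemma MPB_rule_exists:
  assumes "valid_setup S"
  shows "\<exists>d. MPB_rule S d"
proof
  have "(SOME a. a \<in> MPB_offers S \<omega> h p) \<in> MPB_offers S \<omega> h p" for \<omega> h p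
    using MPB_offers_nonempty[OF assms] by (rule some_in_eq[THEN iffD2])
  then show "MPB_rule S (\<lambda>\<omega> h p. return_pmf (SOME a. a \<in> MPB_offers S \<omega> h p))"
    unfolding MPB_rule_def set_return_pmf by blast
qed

lemma MPB_offers_remaining_inventory:
  assumes "arrival_sequence S [p]" and "Some (i, j) \<in> MPB_offers S \<omega> h p"
    and "valid_init (inv_of S i) (card (prices S i)) (\<omega> i)" and "0 < inv_of S i"
  shows "units_sold h i \<noteq> inv_of S i"
proof
  assume eq: "units_sold h i = inv_of S i"
  obtain L \<Phi> where \<omega>: "\<omega> i = (L, \<Phi>)" by force
  let ?k = "inv_of S i"
  have i: "i \<in> items S" "j \<in> price_indices S i" and sc: "0 < score S \<omega> h p (i, j)"
    using assms(2) by (auto simp: MPB_offers_def split: if_splits)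
  have p: "0 \<le> p i j" using assms(1) i by (simp add: arrival_sequence_def)
  have stepk: "\<Phi> (real a / real ?k) \<le> \<Phi> (real (Suc a) / real ?k)" if "a < ?k" for a
    using assms(3) that by (auto simp: valid_init_def \<omega>)
  have mono: "\<Phi> (real a / real ?k) \<le> \<Phi> 1" if "a \<le> ?k" for a
    using that
  proof (induction rule: inc_induct)
    case base
    then show ?case using assms(4) by simp
  next
    case (step n)
    then show ?case using stepk[of n] by (meson order_trans)
  qed
  have "L j \<in> {real a / real ?k | a. a \<le> ?k}" using assms(3) i by (auto simp: valid_init_def \<omega>)
  then have "\<Phi> (L j) \<le> \<Phi> 1" using mono by auto
  then have "p i j * (\<Phi> (L j) - \<Phi> 1) \<le> 0" using p by (simp add: mult_nonneg_nonpos)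
  then show False using sc eq assms(4) by (simp add: score_def \<omega>)
qed

end

theory Submission
  imports Defs
begin

text \<open>
  Fix the initializations. A sale of unit \<open>a\<close> of item \<open>i\<close> at price \<open>j\<close> earns at least its score
  \<open>\<Phi> (L j) - \<Phi> (a / k)\<close> plus the increase of the potential \<open>\<Sum>i. k\<^sub>i * \<Phi>\<^sub>i (N\<^sub>i / k\<^sub>i)\<close>, provided the
  initialization is \<open>admissible\<close>. Since the offers maximize the score, for every LP solution \<open>x\<close> the
  expected revenue is then at least \<open>\<Sum> p * x * \<Phi> (L j)\<close>: the potential pays for the terms
  \<open>p * x * \<Phi> (N / k)\<close>, by the inventory constraints of the LP. So the competitive ratio is at least
  any \<open>c\<close> with \<open>c * price j \<le> E[\<Phi> (L j)]\<close> for all items and prices, and it remains to construct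
  random admissible initializations. For single units, a random reserve price drawn from \<open>\<sigma>\<close> and
  credited with half its value gives \<open>G / 2\<close>. For \<open>k\<close> units, sampling the derivative of the optimal
  value function of the continuum limit at equidistant points with a random offset gives
  \<open>F * k / (k + 1)\<close>, up to a discretization error that vanishes as the offset gets finer.
\<close>

section \<open>Admissible initializations and expected revenue\<close>

definition admissible_init :: "nat \<Rightarrow> real set \<Rightarrow> init \<Rightarrow> bool" where
  "admissible_init k P = (\<lambda>(L, \<Phi>). valid_init k (card P) (L, \<Phi>) \<and>
     (\<forall>a<k. \<forall>j\<in>{1..card P}. \<Phi> (real a / real k) < \<Phi> (L j) \<longrightarrow>
        \<Phi> (L j) - \<Phi> (real a / real k)
          + real k * (\<Phi> (real (Suc a) / real k) - \<Phi> (real a / real k)) \<le> price P j))"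

lemma expectation_bind_finite:
  fixes f :: "'b \<Rightarrow> real"
  assumes "finite (set_pmf p)" "\<And>x. x \<in> set_pmf p \<Longrightarrow> finite (set_pmf (q x))"
  shows "measure_pmf.expectation (bind_pmf p q) f
       = measure_pmf.expectation p (\<lambda>x. measure_pmf.expectation (q x) f)"
  using pmf_expectation_bind[OF assms(1), of q p f] assms
  by (simp add: integral_measure_pmf[OF assms(1)])

lemma expectation_mono_finite:
  fixes f g :: "'b \<Rightarrow> real"
  assumes "finite (set_pmf p)" "\<And>x. x \<in> set_pmf p \<Longrightarrow> f x \<le> g x"
  shows "measure_pmf.expectation p f \<le> measure_pmf.expectation p g"
  using assms by (intro integral_mono_AE integrable_measure_pmf_finite) (auto simp: AE_measure_pmf_iff)

lemma price_mono:
  assumes "price_set P" "i \<le> j" "j \<le> card P"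
  shows "price P i \<le> price P j"
  using assms(2,3)
proof (induction rule: dec_induct)
  case (step n)
  then show ?case using price_props(2)[OF assms(1), of "Suc n"] by simp
qed simp

lemma price_nonneg:
  assumes "price_set P" "j \<le> card P"
  shows "0 \<le> price P j"
  using price_mono[OF assms(1), of 0 j] price_props(1)[OF assms(1)] assms(2) by simp

lemma valid_init_mono:
  assumes "valid_init k m (L, \<Phi>)" "a \<le> b" "b \<le> k"
  shows "\<Phi> (real a / real k) \<le> \<Phi> (real b / real k)"
  using assms(2,3)
proof (induction rule: dec_induct)
  case (step n)
  have "\<Phi> (real n / real k) \<le> \<Phi> (real (Suc n) / real k)"
    using assms(1) step by (auto simp: valid_init_def)
  then show ?case using step by simp
qed simp

lemma valid_init_nonneg:
  assumes "valid_init k m (L, \<Phi>)" "b \<le> k"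
  shows "0 \<le> \<Phi> (real b / real k)"
  using valid_init_mono[OF assms(1), of 0 b] assms by (auto simp: valid_init_def)

lemma units_sold_snoc:
  "units_sold (h @ [(p, a, b)]) i = units_sold h i + (if b \<and> map_option fst a = Some i then 1 else 0)"
  by (simp add: units_sold_def)

lemma revenue_snoc:
  "revenue S (h @ [(p, a, b)]) = revenue S h +
     (case a of Some (i, j) \<Rightarrow> if b then price (prices S i) j else 0 | None \<Rightarrow> 0)"
  by (simp add: revenue_def)

lemma arrival_sequence_Cons:
  "arrival_sequence S (p # ps) \<longleftrightarrow> arrival_sequence S [p] \<and> arrival_sequence S ps"
  by (auto simp: arrival_sequence_def)

lemma finite_MPB_offers:
  assumes "valid_setup S"
  shows "finite (MPB_offers S \<omega> h p)"
proof (rule finite_subset)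
  show "MPB_offers S \<omega> h p \<subseteq> insert None (Some ` Sigma (items S) (price_indices S))"
    by (auto simp: MPB_offers_def split: if_splits)
  show "finite (insert None (Some ` Sigma (items S) (price_indices S)))"
    using assms by (auto simp: valid_setup_def)
qed

lemma finite_set_pmf_response: "finite (set_pmf (response p a))"
  by (rule finite_subset[OF subset_UNIV]) simp

definition potential :: "'i sales_setup \<Rightarrow> ('i \<Rightarrow> init) \<Rightarrow> 'i history \<Rightarrow> real" where
  "potential S \<omega> h =
     (\<Sum>i\<in>items S. real (inv_of S i) * snd (\<omega> i) (real (units_sold h i) / real (inv_of S i)))"

locale balance =
  fixes S :: "'i sales_setup" and \<omega> :: "'i \<Rightarrow> init" and d :: "'i decision"
  assumes S: "valid_setup S"
    and adm: "\<And>i. i \<in> items S \<Longrightarrow> admissible_init (inv_of S i) (prices S i) (\<omega> i)"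
    and d: "\<And>h p. set_pmf (d h p) \<subseteq> MPB_offers S \<omega> h p"
begin

abbreviation level :: "'i history \<Rightarrow> 'i \<Rightarrow> real" where
  "level h i \<equiv> snd (\<omega> i) (real (units_sold h i) / real (inv_of S i))"

lemma fin: "finite (items S)" and inv_pos: "i \<in> items S \<Longrightarrow> 0 < inv_of S i"
  using S by (auto simp: valid_setup_def Suc_le_eq)

lemma valid: "i \<in> items S \<Longrightarrow> valid_init (inv_of S i) (card (prices S i)) (fst (\<omega> i), snd (\<omega> i))"
  using adm[of i] by (auto simp: admissible_init_def split: prod.splits)

lemma finite_set_pmf_d: "finite (set_pmf (d h p))"
  using finite_subset[OF d finite_MPB_offers[OF S]] .

lemma finite_set_pmf_run: "finite (set_pmf (run d h ps))"
  by (induction ps arbitrary: h) (simp_all add: finite_set_pmf_d finite_set_pmf_response)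

lemma offer_inventory:
  assumes "arrival_sequence S [p]" "a \<in> set_pmf (d h p)" "a = Some (i, j)"
    "units_sold h i \<le> inv_of S i"
  shows "i \<in> items S" "j \<in> price_indices S i" "units_sold h i < inv_of S i"
proof -
  have a: "Some (i, j) \<in> MPB_offers S \<omega> h p" using d assms by blast
  then show i: "i \<in> items S" "j \<in> price_indices S i"
    by (auto simp: MPB_offers_def split: if_splits)
  show "units_sold h i < inv_of S i"
    using MPB_offers_remaining_inventory[OF assms(1) a] valid[OF i(1)] inv_pos[OF i(1)] assms(4)
    by fastforce
qed

lemma units_sold_step:
  assumes "arrival_sequence S [p]" "a \<in> set_pmf (d h p)"
    "\<forall>i\<in>items S. units_sold h i \<le> inv_of S i"
  shows "\<forall>i\<in>items S. units_sold (h @ [(p, a, b)]) i \<le> inv_of S i"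
  using offer_inventory[OF assms(1,2)] assms(3) by (fastforce simp: units_sold_snoc)

lemma units_sold_run:
  assumes "arrival_sequence S ps" "\<forall>i\<in>items S. units_sold h i \<le> inv_of S i"
    "h' \<in> set_pmf (run d h ps)" "i \<in> items S"
  shows "units_sold h i \<le> units_sold h' i \<and> units_sold h' i \<le> inv_of S i"
  using assms
proof (induction ps arbitrary: h)
  case (Cons p ps)
  then obtain a b where ab: "a \<in> set_pmf (d h p)" "h' \<in> set_pmf (run d (h @ [(p, a, b)]) ps)"
    by auto
  have "arrival_sequence S [p]" "arrival_sequence S ps"
    using Cons.prems(1) arrival_sequence_Cons by blast+
  then have "units_sold (h @ [(p, a, b)]) i \<le> units_sold h' i \<and> units_sold h' i \<le> inv_of S i"
    using Cons.IH[OF _ units_sold_step ab(2)] ab(1) Cons.prems by blast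
  then show ?case by (simp add: units_sold_snoc)
qed simp

lemma level_nonneg: "\<lbrakk>i \<in> items S; units_sold h i \<le> inv_of S i\<rbrakk> \<Longrightarrow> 0 \<le> level h i"
  using valid_init_nonneg[OF valid] by blast

lemma level_mono:
  "\<lbrakk>i \<in> items S; units_sold h i \<le> units_sold h' i; units_sold h' i \<le> inv_of S i\<rbrakk>
    \<Longrightarrow> level h i \<le> level h' i"
  using valid_init_mono[OF valid] by blast

lemma potential_snoc_sale:
  assumes "i \<in> items S"
  shows "potential S \<omega> (h @ [(p, Some (i, j), True)]) = potential S \<omega> h +
    real (inv_of S i) * (snd (\<omega> i) (real (Suc (units_sold h i)) / real (inv_of S i)) - level h i)"
  unfolding potential_def sum.remove[OF fin assms]
  by (simp add: units_sold_snoc algebra_simps) (rule sum.cong, auto)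

lemma expected_step:
  assumes p: "arrival_sequence S [p]" and h: "\<forall>i\<in>items S. units_sold h i \<le> inv_of S i"
    and a: "a \<in> set_pmf (d h p)"
  shows "revenue S h - potential S \<omega> h + max 0 (max_score S \<omega> h p) \<le>
    measure_pmf.expectation (response p a)
      (\<lambda>b. revenue S (h @ [(p, a, b)]) - potential S \<omega> (h @ [(p, a, b)]))"
proof (cases a)
  case None
  then have "max_score S \<omega> h p \<le> 0"
    using a d[of h p] by (force simp: MPB_offers_def split: if_splits)
  then show ?thesis using None
    by (simp add: response_def revenue_snoc potential_def units_sold_snoc)
next
  case (Some ij)
  obtain i j where a': "a = Some (i, j)" using Some by (cases ij) auto
  then have ijM: "Some (i, j) \<in> MPB_offers S \<omega> h p" using a d by blast
  have i: "i \<in> items S" and j: "j \<in> price_indices S i" and less: "units_sold h i < inv_of S i"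
    using offer_inventory[OF p a a'] h offer_inventory(1)[OF p a a'] ijM
    by (auto simp: MPB_offers_def split: if_splits)
  define \<Delta> where "\<Delta> = real (inv_of S i) *
    (snd (\<omega> i) (real (Suc (units_sold h i)) / real (inv_of S i)) - level h i)"
  have ms: "0 < max_score S \<omega> h p"
    and sc: "max_score S \<omega> h p = p i j * (snd (\<omega> i) (fst (\<omega> i) j) - level h i)"
    using ijM by (auto simp: MPB_offers_def score_def case_prod_unfold split: if_splits)
  have pij: "0 \<le> p i j" "p i j \<le> 1" using p i j by (auto simp: arrival_sequence_def)
  have "0 < snd (\<omega> i) (fst (\<omega> i) j) - level h i"
    using ms pij(1) unfolding sc by (simp add: zero_less_mult_iff)
  then have "snd (\<omega> i) (fst (\<omega> i) j) - level h i + \<Delta> \<le> price (prices S i) j"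
    using adm[OF i] less j by (auto simp: admissible_init_def case_prod_unfold \<Delta>_def)
  then have "p i j * (snd (\<omega> i) (fst (\<omega> i) j) - level h i) \<le> p i j * (price (prices S i) j - \<Delta>)"
    using pij by (intro mult_left_mono) auto
  moreover have "measure_pmf.expectation (response p a)
      (\<lambda>b. revenue S (h @ [(p, a, b)]) - potential S \<omega> (h @ [(p, a, b)])) =
      revenue S h - potential S \<omega> h + p i j * (price (prices S i) j - \<Delta>)"
  proof -
    have "potential S \<omega> (h @ [(p, Some (i, j), False)]) = potential S \<omega> h"
      by (simp add: potential_def units_sold_snoc)
    then show ?thesis using pij
      by (simp add: a' response_def revenue_snoc potential_snoc_sale[OF i] \<Delta>_def algebra_simps)
  qed
  ultimately show ?thesis using ms sc by simp
qed

lemma fractional_score_le: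
  assumes p: "arrival_sequence S [p]"
    and x0: "\<And>i j. \<lbrakk>i \<in> items S; j \<in> price_indices S i\<rbrakk> \<Longrightarrow> 0 \<le> x i j"
    and x1: "(\<Sum>i\<in>items S. \<Sum>j\<in>price_indices S i. x i j) \<le> 1"
  shows "(\<Sum>i\<in>items S. \<Sum>j\<in>price_indices S i.
      p i j * x i j * (snd (\<omega> i) (fst (\<omega> i) j) - level h i)) \<le> max 0 (max_score S \<omega> h p)"
proof -
  let ?I = "Sigma (items S) (price_indices S)" and ?M = "max 0 (max_score S \<omega> h p)"
  have sM: "p i j * (snd (\<omega> i) (fst (\<omega> i) j) - level h i) \<le> ?M"
    if "i \<in> items S" "j \<in> price_indices S i" for i j
  proof -
    have "score S \<omega> h p (i, j) \<le> max_score S \<omega> h p"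
      unfolding max_score_def using that fin by (intro Max_ge) auto
    then show ?thesis by (simp add: score_def case_prod_unfold)
  qed
  have "(\<Sum>i\<in>items S. \<Sum>j\<in>price_indices S i.
      p i j * x i j * (snd (\<omega> i) (fst (\<omega> i) j) - level h i))
      \<le> (\<Sum>i\<in>items S. \<Sum>j\<in>price_indices S i. x i j * ?M)"
    using mult_left_mono[OF sM x0] by (intro sum_mono) (simp add: mult_ac)
  also have "\<dots> = (\<Sum>i\<in>items S. \<Sum>j\<in>price_indices S i. x i j) * ?M"
    by (simp add: sum_distrib_right)
  also have "\<dots> \<le> 1 * ?M" using x1 by (intro mult_right_mono) auto
  finally show ?thesis by simp
qed

text \<open>
  The level in the term for \<open>x\<close> is that of the final history; it only increases in the course of
  the run.
\<close>

lemma expected_run: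
  assumes "arrival_sequence S ps" "\<forall>i\<in>items S. units_sold h i \<le> inv_of S i"
    and "\<And>t i j. \<lbrakk>t < length ps; i \<in> items S; j \<in> price_indices S i\<rbrakk> \<Longrightarrow> 0 \<le> x t i j"
    and "\<And>t. t < length ps \<Longrightarrow> (\<Sum>i\<in>items S. \<Sum>j\<in>price_indices S i. x t i j) \<le> 1"
  shows "revenue S h - potential S \<omega> h \<le>
    measure_pmf.expectation (run d h ps) (\<lambda>h'. revenue S h' - potential S \<omega> h' -
      (\<Sum>t<length ps. \<Sum>i\<in>items S. \<Sum>j\<in>price_indices S i.
         (ps ! t) i j * x t i j * (snd (\<omega> i) (fst (\<omega> i) j) - level h' i)))"
  using assms
proof (induction ps arbitrary: h x)
  case (Cons p ps)
  let ?E = measure_pmf.expectation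
  let ?C = "\<lambda>p x h'. \<Sum>i\<in>items S. \<Sum>j\<in>price_indices S i.
    p i j * x i j * (snd (\<omega> i) (fst (\<omega> i) j) - level h' i)"
  let ?T = "\<lambda>h'. \<Sum>t<length ps. ?C (ps ! t) (x (Suc t)) h'"
  let ?v = "\<lambda>h'. revenue S h' - potential S \<omega> h'"
  have p: "arrival_sequence S [p]" and ps: "arrival_sequence S ps"
    using Cons.prems(1) arrival_sequence_Cons by blast+
  have C0: "?C p (x 0) h \<le> max 0 (max_score S \<omega> h p)"
    using Cons.prems(3)[of 0] Cons.prems(4)[of 0] by (intro fractional_score_le p) auto
  have IH: "?v (h @ [(p, a, b)]) - ?C p (x 0) h
      \<le> ?E (run d (h @ [(p, a, b)]) ps) (\<lambda>h'. ?v h' - ?T h' - ?C p (x 0) h')"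
    if a: "a \<in> set_pmf (d h p)" for a b
  proof -
    let ?h = "h @ [(p, a, b)]"
    have h1: "\<forall>i\<in>items S. units_sold ?h i \<le> inv_of S i"
      by (rule units_sold_step[OF p a Cons.prems(2)])
    have mono: "?C p (x 0) h' \<le> ?C p (x 0) h" if "h' \<in> set_pmf (run d ?h ps)" for h'
    proof (intro sum_mono mult_left_mono diff_left_mono)
      fix i j assume i: "i \<in> items S" and j: "j \<in> price_indices S i"
      have "units_sold h i \<le> units_sold ?h i" by (simp add: units_sold_snoc)
      then show "level h i \<le> level h' i"
        using units_sold_run[OF ps h1 that i] by (intro level_mono i) auto
      show "0 \<le> p i j * x 0 i j"
        using p i j Cons.prems(3)[of 0 i j] by (auto simp: arrival_sequence_def)
    qed
    note int = integrable_measure_pmf_finite[OF finite_set_pmf_run]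
    have "?v ?h \<le> ?E (run d ?h ps) (\<lambda>h'. ?v h' - ?T h')"
      by (rule Cons.IH[OF ps h1]) (use Cons.prems(3,4) in auto)
    also have "\<dots> = ?E (run d ?h ps) (\<lambda>h'. ?v h' - ?T h' - ?C p (x 0) h) + ?C p (x 0) h"
      by (subst Bochner_Integration.integral_diff[OF int int]) simp
    also have "\<dots> \<le> ?E (run d ?h ps) (\<lambda>h'. ?v h' - ?T h' - ?C p (x 0) h') + ?C p (x 0) h"
      using mono by (intro add_right_mono expectation_mono_finite finite_set_pmf_run) force
    finally show ?thesis by simp
  qed
  have "?v h \<le> ?E (response p a) (\<lambda>b. ?v (h @ [(p, a, b)]) - ?C p (x 0) h)"
    if a: "a \<in> set_pmf (d h p)" for a
    using expected_step[OF p Cons.prems(2) a] C0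
    by (subst Bochner_Integration.integral_diff)
       (auto intro!: integrable_measure_pmf_finite finite_set_pmf_response)
  moreover have "?E (response p a) (\<lambda>b. ?v (h @ [(p, a, b)]) - ?C p (x 0) h) \<le>
     ?E (response p a) (\<lambda>b. ?E (run d (h @ [(p, a, b)]) ps) (\<lambda>h'. ?v h' - ?T h' - ?C p (x 0) h'))"
    if a: "a \<in> set_pmf (d h p)" for a
    by (intro expectation_mono_finite finite_set_pmf_response IH a)
  ultimately have le: "?v h \<le>
     ?E (response p a) (\<lambda>b. ?E (run d (h @ [(p, a, b)]) ps) (\<lambda>h'. ?v h' - ?T h' - ?C p (x 0) h'))"
    if a: "a \<in> set_pmf (d h p)" for a
    using that by force
  have "?v h = ?E (d h p) (\<lambda>a. ?v h)" by simp
  also have "\<dots> \<le> ?E (d h p) (\<lambda>a. ?E (response p a) (\<lambda>b.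
      ?E (run d (h @ [(p, a, b)]) ps) (\<lambda>h'. ?v h' - ?T h' - ?C p (x 0) h')))"
    by (intro expectation_mono_finite finite_set_pmf_d le)
  also have "\<dots> = ?E (run d h (p # ps)) (\<lambda>h'. ?v h' - ?T h' - ?C p (x 0) h')"
    by (simp add: expectation_bind_finite finite_set_pmf_d finite_set_pmf_response finite_set_pmf_run)
  finally show ?case by (simp del: sum.lessThan_Suc add: sum.lessThan_Suc_shift algebra_simps)
qed simp

lemma expected_revenue_ge:
  assumes A: "arrival_sequence S A" and x: "LP_feasible S A x"
  shows "(\<Sum>t<length A. \<Sum>i\<in>items S. \<Sum>j\<in>price_indices S i.
      (A ! t) i j * x t i j * snd (\<omega> i) (fst (\<omega> i) j))
    \<le> measure_pmf.expectation (run d [] A) (revenue S)"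
proof -
  let ?E = "measure_pmf.expectation (run d [] A)"
  let ?V = "\<Sum>t<length A. \<Sum>i\<in>items S. \<Sum>j\<in>price_indices S i.
      (A ! t) i j * x t i j * snd (\<omega> i) (fst (\<omega> i) j)"
  have init: "potential S \<omega> [] = 0" "\<forall>i\<in>items S. units_sold [] i \<le> inv_of S i"
    using valid by (auto simp: potential_def units_sold_def valid_init_def case_prod_unfold intro!: sum.neutral)
  have "0 \<le> ?E (\<lambda>h. revenue S h - potential S \<omega> h -
      (\<Sum>t<length A. \<Sum>i\<in>items S. \<Sum>j\<in>price_indices S i.
         (A ! t) i j * x t i j * (snd (\<omega> i) (fst (\<omega> i) j) - level h i)))"
    using expected_run[OF A init(2), of x] x init(1) by (simp add: LP_feasible_def revenue_def)
  also have "\<dots> \<le> ?E (\<lambda>h. revenue S h - ?V)"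
  proof (intro expectation_mono_finite finite_set_pmf_run)
    fix h assume h: "h \<in> set_pmf (run d [] A)"
    have "(\<Sum>t<length A. \<Sum>i\<in>items S. \<Sum>j\<in>price_indices S i. (A ! t) i j * x t i j * level h i)
      = (\<Sum>i\<in>items S. (\<Sum>t<length A. \<Sum>j\<in>price_indices S i. (A ! t) i j * x t i j) * level h i)"
      by (subst sum.swap) (simp add: sum_distrib_right)
    also have "\<dots> \<le> potential S \<omega> h"
      unfolding potential_def
      using x units_sold_run[OF A init(2) h]
      by (intro sum_mono mult_right_mono level_nonneg) (auto simp: LP_feasible_def)
    finally show "revenue S h - potential S \<omega> h -
      (\<Sum>t<length A. \<Sum>i\<in>items S. \<Sum>j\<in>price_indices S i.
         (A ! t) i j * x t i j * (snd (\<omega> i) (fst (\<omega> i) j) - level h i)) \<le> revenue S h - ?V"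
      by (simp add: right_diff_distrib sum_subtractf)
  qed
  also have "\<dots> = ?E (revenue S) - ?V"
    by (subst Bochner_Integration.integral_diff)
       (auto intro!: integrable_measure_pmf_finite finite_set_pmf_run)
  finally show ?thesis by simp
qed

end

lemma MPB_expected_revenue_ge:
  assumes S: "valid_setup S" and A: "arrival_sequence S A" and x: "LP_feasible S A x"
    and d: "MPB_rule S d"
    and fin: "\<And>i. i \<in> items S \<Longrightarrow> finite (set_pmf (D i))"
    and adm: "\<And>i \<omega>. \<lbrakk>i \<in> items S; \<omega> \<in> set_pmf (D i)\<rbrakk>
      \<Longrightarrow> admissible_init (inv_of S i) (prices S i) \<omega>"
    and val: "\<And>i j. \<lbrakk>i \<in> items S; j \<in> price_indices S i\<rbrakk>
      \<Longrightarrow> c i * price (prices S i) j \<le> measure_pmf.expectation (D i) (\<lambda>(L, \<Phi>). \<Phi> (L j))"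
    and c: "\<And>i. i \<in> items S \<Longrightarrow> c0 \<le> c i"
  shows "c0 * LP_value S A x \<le> measure_pmf.expectation (MPB_revenue S D d A) (\<lambda>v. v)"
proof -
  let ?P = "Pi_pmf (items S) undefined D"
  let ?E = measure_pmf.expectation
  have finS: "finite (items S)" using S by (simp add: valid_setup_def)
  have setP: "set_pmf ?P = PiE_dflt (items S) undefined (set_pmf \<circ> D)"
    by (rule set_Pi_pmf[OF finS])
  have finP: "finite (set_pmf ?P)"
    unfolding setP using fin finS by (intro finite_PiE_dflt) auto
  have bal: "balance S \<omega> (d \<omega>)" if "\<omega> \<in> set_pmf ?P" for \<omega>
  proof
    show "valid_setup S" by (rule S)
    show "admissible_init (inv_of S i) (prices S i) (\<omega> i)" if "i \<in> items S" for i
      using \<open>\<omega> \<in> set_pmf ?P\<close> that by (intro adm) (auto simp: setP PiE_dflt_def)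
    show "set_pmf (d \<omega> h p) \<subseteq> MPB_offers S \<omega> h p" for h p
      using d by (auto simp: MPB_rule_def)
  qed
  note int = integrable_measure_pmf_finite[OF finP]
  have "c0 * LP_value S A x = (\<Sum>t<length A. \<Sum>i\<in>items S. \<Sum>j\<in>price_indices S i.
      (A ! t) i j * x t i j * (c0 * price (prices S i) j))"
    by (simp add: LP_value_def sum_distrib_left mult_ac)
  also have "\<dots> \<le> (\<Sum>t<length A. \<Sum>i\<in>items S. \<Sum>j\<in>price_indices S i.
      (A ! t) i j * x t i j * ?E ?P (\<lambda>\<omega>. snd (\<omega> i) (fst (\<omega> i) j)))"
  proof (intro sum_mono mult_left_mono)
    fix t i j assume t: "t \<in> {..<length A}" and i: "i \<in> items S" and j: "j \<in> price_indices S i"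
    have "price_set (prices S i)" using S i by (simp add: valid_setup_def)
    then have "0 \<le> price (prices S i) j" using j by (intro price_nonneg) auto
    then have "c0 * price (prices S i) j \<le> c i * price (prices S i) j"
      using c[OF i] by (rule mult_right_mono[rotated])
    also have "\<dots> \<le> ?E (map_pmf (\<lambda>\<omega>. \<omega> i) ?P) (\<lambda>(L, \<Phi>). \<Phi> (L j))"
      using val[OF i j] by (simp add: Pi_pmf_component[OF finS] i)
    finally show "c0 * price (prices S i) j \<le> ?E ?P (\<lambda>\<omega>. snd (\<omega> i) (fst (\<omega> i) j))"
      by (simp add: case_prod_unfold)
    show "0 \<le> (A ! t) i j * x t i j"
      using A x t i j nth_mem[of t A]
      by (auto simp: arrival_sequence_def LP_feasible_def simp del: nth_mem)
  qed
  also have "\<dots> = ?E ?P (\<lambda>\<omega>. \<Sum>t<length A. \<Sum>i\<in>items S. \<Sum>j\<in>price_indices S i.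
      (A ! t) i j * x t i j * snd (\<omega> i) (fst (\<omega> i) j))"
    by (simp add: Bochner_Integration.integral_sum int)
  also have "\<dots> \<le> ?E ?P (\<lambda>\<omega>. ?E (run (d \<omega>) [] A) (revenue S))"
    by (intro expectation_mono_finite finP balance.expected_revenue_ge[OF bal] A x)
  also have "\<dots> = ?E (MPB_revenue S D d A) (\<lambda>v. v)"
    unfolding MPB_revenue_def
    by (subst expectation_bind_finite) (auto simp: finP balance.finite_set_pmf_run[OF bal])
  finally show ?thesis .
qed

section \<open>Splitting items into single units\<close>

lemma split_setup_sel:
  "items (split_setup Q S) = Sigma (items S) (\<lambda>i. if i \<in> Q then {..<inv_of S i} else {0})"
  "inv_of (split_setup Q S) il = (if fst il \<in> Q then 1 else inv_of S (fst il))"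
  "prices (split_setup Q S) il = prices S (fst il)"
  by (auto simp: split_setup_def case_prod_unfold)

lemma valid_split_setup:
  assumes "valid_setup S"
  shows "valid_setup (split_setup Q S)"
proof -
  obtain i where i: "i \<in> items S" using assms by (auto simp: valid_setup_def)
  moreover have "0 < inv_of S i" using assms i by (auto simp: valid_setup_def Suc_le_eq)
  ultimately have "(i, 0) \<in> items (split_setup Q S)" by (simp add: split_setup_sel)
  then have "items (split_setup Q S) \<noteq> {}" by blast
  then show ?thesis using assms
    unfolding valid_setup_def split_setup_sel by (auto split: if_splits)
qed

lemma arrival_sequence_split:
  "arrival_sequence S A \<Longrightarrow> arrival_sequence (split_setup Q S) (map split_customer A)"
  by (auto simp: arrival_sequence_def split_customer_def split_setup_sel)

definition copies :: "'i set \<Rightarrow> 'i sales_setup \<Rightarrow> 'i \<Rightarrow> nat" where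
  "copies Q S i = (if i \<in> Q then inv_of S i else 1)"

lemma split_LP_solution:
  fixes Q :: "'a set"
  assumes S: "valid_setup S" and x: "LP_feasible S A x"
  defines "x' \<equiv> \<lambda>t (i, l :: nat) j. x t i j / real (copies Q S i)"
  shows "LP_feasible (split_setup Q S) (map split_customer A) x'"
    and "LP_value (split_setup Q S) (map split_customer A) x' = LP_value S A x"
proof -
  let ?S = "split_setup Q S" and ?A = "map split_customer A"
  have fin: "finite (items S)" using S by (simp add: valid_setup_def)
  have cp: "0 < real (copies Q S i)" if "i \<in> items S" for i
    using S that by (auto simp: valid_setup_def copies_def Suc_le_eq)
  have inv: "real (inv_of ?S (i, l)) = real (inv_of S i) / real (copies Q S i)" if "i \<in> items S" for i l
    using cp[OF that] by (auto simp: split_setup_sel copies_def)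
  have items_eq: "items ?S = Sigma (items S) (\<lambda>i. {..<copies Q S i})"
    by (auto simp: split_setup_sel copies_def)
  have S_sum: "(\<Sum>il\<in>items ?S. g (fst il) / real (copies Q S (fst il))) = (\<Sum>i\<in>items S. g i)"
    for g :: "'a \<Rightarrow> real"
  proof -
    have "(\<Sum>il\<in>items ?S. g (fst il) / real (copies Q S (fst il)))
        = (\<Sum>i\<in>items S. \<Sum>l<copies Q S i. g i / real (copies Q S i))"
      unfolding items_eq by (subst sum.Sigma) (auto simp: fin case_prod_unfold)
    also have "\<dots> = (\<Sum>i\<in>items S. g i)" using cp by (intro sum.cong) auto
    finally show ?thesis .
  qed
  have x'_eq: "x' t il j = x t (fst il) j / real (copies Q S (fst il))" for t il j
    by (simp add: x'_def case_prod_unfold)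
  have A_eq: "split_customer p il j = p (fst il) j" for p :: "'a customer" and il j
    by (simp add: split_customer_def case_prod_unfold)
  show "LP_feasible ?S ?A x'"
    unfolding LP_feasible_def
  proof (intro conjI ballI allI impI)
    fix il assume il: "il \<in> items ?S"
    then have i: "fst il \<in> items S" by (auto simp: items_eq)
    have "(\<Sum>t<length ?A. \<Sum>j\<in>price_indices ?S il. (?A ! t) il j * x' t il j)
        = (\<Sum>t<length A. \<Sum>j\<in>price_indices S (fst il). (A ! t) (fst il) j * x t (fst il) j)
          / real (copies Q S (fst il))"
      by (simp add: A_eq x'_eq split_setup_sel sum_divide_distrib cong: sum.cong_simp)
    also have "\<dots> \<le> real (inv_of S (fst il)) / real (copies Q S (fst il))"
      using x i cp[OF i] by (intro divide_right_mono) (auto simp: LP_feasible_def)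
    also have "\<dots> = real (inv_of ?S il)" using inv[OF i, of "snd il"] by simp
    finally show "(\<Sum>t<length ?A. \<Sum>j\<in>price_indices ?S il. (?A ! t) il j * x' t il j)
      \<le> real (inv_of ?S il)" .
  next
    fix t assume t: "t < length ?A"
    have "(\<Sum>il\<in>items ?S. \<Sum>j\<in>price_indices ?S il. x' t il j)
        = (\<Sum>il\<in>items ?S. (\<Sum>j\<in>price_indices S (fst il). x t (fst il) j)
            / real (copies Q S (fst il)))"
      by (simp add: x'_eq split_setup_sel(3) sum_divide_distrib)
    also have "\<dots> \<le> 1"
      using S_sum[of "\<lambda>i. \<Sum>j\<in>price_indices S i. x t i j"] x t
      by (simp add: LP_feasible_def)
    finally show "(\<Sum>il\<in>items ?S. \<Sum>j\<in>price_indices ?S il. x' t il j) \<le> 1" .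
  next
    fix t il j assume "t < length ?A" "il \<in> items ?S" "j \<in> price_indices ?S il"
    then show "0 \<le> x' t il j"
      using x by (auto simp: LP_feasible_def x'_eq items_eq split_setup_sel(3) intro!: divide_nonneg_nonneg)
  qed
  have "LP_value ?S ?A x' = (\<Sum>t<length A. \<Sum>il\<in>items ?S.
      (\<Sum>j\<in>price_indices S (fst il). (A ! t) (fst il) j * price (prices S (fst il)) j * x t (fst il) j)
        / real (copies Q S (fst il)))"
    by (simp add: LP_value_def A_eq x'_eq split_setup_sel(3) sum_divide_distrib cong: sum.cong_simp)
  also have "\<dots> = LP_value S A x"
    unfolding LP_value_def
    by (intro sum.cong refl)
       (rule S_sum[of "\<lambda>i. \<Sum>j\<in>price_indices S i. (A ! t) i j * price (prices S i) j * x t i j" for t])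
  finally show "LP_value ?S ?A x' = LP_value S A x" .
qed

lemma split_MPB_competitive:
  assumes S: "valid_setup S"
    and d: "MPB_rule (split_setup Q S) d"
    and fin: "\<And>i. i \<in> items S \<Longrightarrow> finite (set_pmf (D i))"
    and adm: "\<And>i \<omega>. \<lbrakk>i \<in> items S; \<omega> \<in> set_pmf (D i)\<rbrakk>
      \<Longrightarrow> admissible_init (if i \<in> Q then 1 else inv_of S i) (prices S i) \<omega>"
    and val: "\<And>i j. \<lbrakk>i \<in> items S; j \<in> price_indices S i\<rbrakk>
      \<Longrightarrow> c i * price (prices S i) j \<le> measure_pmf.expectation (D i) (\<lambda>(L, \<Phi>). \<Phi> (L j))"
    and c0: "0 \<le> c0"
    and c: "\<And>i. i \<in> items S \<Longrightarrow> c0 \<le> c i"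
  shows "achieves_competitive_ratio S
    (\<lambda>A. MPB_revenue (split_setup Q S) (\<lambda>(i, l). D i) d (map split_customer A)) c0"
  unfolding achieves_competitive_ratio_def
proof (intro allI impI)
  fix A assume A: "arrival_sequence S A"
  let ?S = "split_setup Q S" and ?A = "map split_customer A"
  let ?R = "measure_pmf.expectation (MPB_revenue ?S (\<lambda>(i, l). D i) d ?A) (\<lambda>v. v)"
  have le: "c0 * LP_value S A x \<le> ?R" if x: "LP_feasible S A x" for x
  proof -
    let ?x = "\<lambda>t (i, l :: nat) j. x t i j / real (copies Q S i)"
    have item: "fst il \<in> items S" if "il \<in> items ?S" for il
      using that by (auto simp: split_setup_sel)
    have "c0 * LP_value ?S ?A ?x \<le> ?R"
    proof (rule MPB_expected_revenue_ge[where c = "\<lambda>il. c (fst il)"])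
      show "valid_setup ?S" by (rule valid_split_setup[OF S])
      show "arrival_sequence ?S ?A" by (rule arrival_sequence_split[OF A])
      show "LP_feasible ?S ?A ?x" by (rule split_LP_solution(1)[OF S x])
      show "MPB_rule ?S d" by (rule d)
      fix il assume il: "il \<in> items ?S"
      show "finite (set_pmf (case il of (i, l) \<Rightarrow> D i))" "c0 \<le> c (fst il)"
        using fin[OF item[OF il]] c[OF item[OF il]] by (simp_all add: case_prod_unfold)
      show "admissible_init (inv_of ?S il) (prices ?S il) \<omega>"
        if "\<omega> \<in> set_pmf (case il of (i, l) \<Rightarrow> D i)" for \<omega>
        using adm[OF item[OF il], of \<omega>] that by (simp add: split_setup_sel case_prod_unfold)
      show "c (fst il) * price (prices ?S il) j
          \<le> measure_pmf.expectation (case il of (i, l) \<Rightarrow> D i) (\<lambda>(L, \<Phi>). \<Phi> (L j))"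
        if "j \<in> price_indices ?S il" for j
        using val[OF item[OF il], of j] that
        by (simp add: split_setup_sel case_prod_unfold)
    qed
    then show ?thesis by (simp only: split_LP_solution(2)[OF S x])
  qed
  show "c0 * OPT S A \<le> ?R"
  proof (cases "c0 = 0")
    case True
    then show ?thesis using le[OF LP_feasible_zero] by simp
  next
    case False
    have "OPT S A \<le> ?R / c0"
      unfolding OPT_def
      using False c0 le LP_feasible_zero
      by (intro cSUP_least) (auto simp: field_simps)
    then show ?thesis using False c0 by (simp add: field_simps)
  qed
qed

section \<open>Construction of the random initializations\<close>

lemma finite_pmf_exists:
  fixes f :: "'a \<Rightarrow> real"
  assumes "finite A" "\<And>x. x \<in> A \<Longrightarrow> 0 \<le> f x" "sum f A = 1"
  obtains p where "set_pmf p \<subseteq> A"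
    "\<And>g :: 'a \<Rightarrow> real. measure_pmf.expectation p g = (\<Sum>x\<in>A. f x * g x)"
proof -
  define F where "F x = (if x \<in> A then f x else 0)" for x
  have nn: "0 \<le> F x" for x using assms(2) by (simp add: F_def)
  have "(\<integral>\<^sup>+x. ennreal (F x) \<partial>count_space UNIV) = (\<Sum>x\<in>A. ennreal (F x))"
    by (intro nn_integral_count_space'[OF assms(1)]) (auto simp: F_def)
  also have "\<dots> = 1"
    using assms by (subst sum_ennreal) (simp_all add: F_def)
  finally have one: "(\<integral>\<^sup>+x. ennreal (F x) \<partial>count_space UNIV) = 1" .
  have pmf: "pmf (embed_pmf F) x = F x" for x
    by (rule pmf_embed_pmf[OF nn one])
  have sub: "set_pmf (embed_pmf F) \<subseteq> A"
    by (auto simp: set_pmf_eq pmf F_def split: if_splits)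
  show ?thesis
  proof
    show "set_pmf (embed_pmf F) \<subseteq> A" by (rule sub)
    show "measure_pmf.expectation (embed_pmf F) g = (\<Sum>x\<in>A. f x * g x)" for g :: "'a \<Rightarrow> real"
      using sub by (subst integral_measure_pmf_real[OF assms(1)])
        (auto simp: pmf F_def mult_ac intro!: sum.cong)
  qed
qed

lemma sigmas_sigma_system:
  assumes "price_set P"
  shows "sigma_system P (sigmas P)"
  using theI'[OF sigma_system_unique_solution[OF assms]] by (simp add: sigmas_def)

lemma alphas_alpha_system:
  assumes "price_set P"
  shows "alpha_system P (alphas P)"
  using theI'[OF alpha_system_unique_solution[OF assms]] by (simp add: alphas_def)

lemma sigmas_eq:
  assumes "price_set P" "j \<in> {1..card P}"
  shows "sigmas P j * price P j = G_val P * (price P j - price P (j - 1))"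
proof (cases "j = 1")
  case True
  then show ?thesis by (simp add: G_val_def price_props(1)[OF assms(1)])
next
  case False
  have "G_val P = sigmas P j / price_weight P j"
    using sigmas_sigma_system[OF assms(1)] assms(2) False
    by (auto simp: sigma_system_def G_val_def price_weight_def)
  then have "sigmas P j = G_val P * price_weight P j"
    using price_weight_props(2)[OF assms] by (simp add: field_simps)
  then show ?thesis using price_props(2)[OF assms] by (simp add: price_weight_def field_simps)
qed

lemma single_unit_init:
  assumes P: "price_set P"
  obtains D where "finite (set_pmf D)"
    "\<And>\<omega>. \<omega> \<in> set_pmf D \<Longrightarrow> admissible_init 1 P \<omega>"
    "\<And>j. j \<in> {1..card P} \<Longrightarrow>
      G_val P / 2 * price P j \<le> measure_pmf.expectation D (\<lambda>(L, \<Phi>). \<Phi> (L j))"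
proof -
  let ?m = "card P"
  have sys: "sigma_system P (sigmas P)" by (rule sigmas_sigma_system[OF P])
  obtain p where p: "set_pmf p \<subseteq> {1..?m}"
    "\<And>g :: nat \<Rightarrow> real. measure_pmf.expectation p g = (\<Sum>l = 1..?m. sigmas P l * g l)"
  proof (rule finite_pmf_exists[of "{1..?m}" "sigmas P"])
    show "0 \<le> sigmas P l" if "l \<in> {1..?m}" for l
      using sys that unfolding sigma_system_def by (metis less_imp_le)
    show "sum (sigmas P) {1..?m} = 1" using sys by (simp add: sigma_system_def)
  qed (auto intro: that)
  define I :: "nat \<Rightarrow> init" where
    "I l = (\<lambda>j. if l \<le> j then 1 else 0, \<lambda>y. y * (price P l / 2))" for l
  show ?thesis
  proof
    show "finite (set_pmf (map_pmf I p))"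
      using finite_subset[OF p(1)] by simp
    show "admissible_init 1 P \<omega>" if \<omega>: "\<omega> \<in> set_pmf (map_pmf I p)" for \<omega>
    proof -
      obtain l where l: "l \<in> {1..?m}" "\<omega> = I l"
        using \<omega> p(1) unfolding set_map_pmf by blast
      have "\<exists>a. (if l \<le> j then 1 else 0) = real a \<and> a \<le> Suc 0" for j
        by (rule exI[of _ "if l \<le> j then 1 else 0"]) auto
      then have "valid_init 1 ?m (I l)"
        using l(1) price_nonneg[OF P, of l] by (auto simp: valid_init_def I_def)
      moreover have "price P l \<le> price P j" if "l \<le> j" "j \<in> {1..?m}" for j
        using price_mono[OF P that(1)] that(2) by simp
      ultimately show ?thesis
        by (auto simp: admissible_init_def I_def l(2))
    qed
    fix j assume j: "j \<in> {1..?m}"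
    have eq: "(\<Sum>l = 1..i. sigmas P l * price P l) = G_val P * price P i" if "i \<le> ?m" for i
      using that
    proof (induction i)
      case (Suc i)
      then show ?case using sigmas_eq[OF P, of "Suc i"] by (simp add: algebra_simps)
    qed (simp add: price_props(1)[OF P])
    have "G_val P / 2 * price P j = (\<Sum>l = 1..j. sigmas P l * price P l) / 2"
      using eq[of j] j by simp
    also have "\<dots> = (\<Sum>l = 1..j. sigmas P l * ((if l \<le> j then 1 else 0) * (price P l / 2)))"
      by (simp add: sum_divide_distrib)
    also have "\<dots> = (\<Sum>l = 1..?m. sigmas P l * ((if l \<le> j then 1 else 0) * (price P l / 2)))"
      using j by (intro sum.mono_neutral_left) auto
    also have "\<dots> = measure_pmf.expectation (map_pmf I p) (\<lambda>(L, \<Phi>). \<Phi> (L j))"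
      by (simp only: integral_map_pmf I_def prod.case p(2))
    finally show "G_val P / 2 * price P j
        \<le> measure_pmf.expectation (map_pmf I p) (\<lambda>(L, \<Phi>). \<Phi> (L j))"
      by (rule eq_refl)
  qed
qed

lemma down_closed_eq_lessThan:
  fixes A :: "nat set"
  assumes "finite A" "\<And>a b. \<lbrakk>a \<in> A; b < a\<rbrakk> \<Longrightarrow> b \<in> A"
  shows "A = {..<card A}"
proof (cases "A = {}")
  case False
  have "A = {..Max A}"
  proof (intro equalityI subsetI)
    show "x \<in> A" if "x \<in> {..Max A}" for x
      using that assms(2)[OF Max_in[OF assms(1) False], of x] Max_in[OF assms(1) False]
      by (cases "x = Max A") auto
  qed (simp add: assms(1))
  then show ?thesis by (metis card_atMost lessThan_Suc_atMost)
qed simp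

lemma sum_blocks:
  fixes f :: "nat \<Rightarrow> real"
  shows "(\<Sum>s = 1..M. \<Sum>a<k. f (a * M + s)) = sum f {1..k * M}"
proof (induction k)
  case (Suc k)
  have "sum f {1..Suc k * M} = sum f {1..k * M} + sum f {k * M + 1..k * M + M}"
    using sum.ub_add_nat[of 1 "k * M" f M] by (simp add: add.commute)
  also have "sum f {k * M + 1..k * M + M} = (\<Sum>s = 1..M. f (k * M + s))"
    by (rule sum.reindex_bij_witness[of _ "\<lambda>s. k * M + s" "\<lambda>n. n - k * M"]) auto
  finally show ?case using Suc by (simp add: sum.distrib)
qed simp

lemma exp_ge_one_plus_inverse: "1 + 1 / real k \<le> exp (1 / real k)"
  by (rule exp_ge_add_one_self)

lemma exp_decay_sum_le:
  assumes "0 < k"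
  shows "real k * exp (- real t / real k) + (\<Sum>i<Suc t. exp (- real i / real k)) \<le> real k + 1"
proof (induction t)
  case (Suc t)
  have "(1 + 1 / real k) * exp (- 1 / real k) \<le> exp (1 / real k) * exp (- 1 / real k)"
    by (intro mult_right_mono exp_ge_one_plus_inverse) auto
  also have "\<dots> = 1" by (simp flip: exp_add)
  finally have "(real k + 1) * exp (- 1 / real k) \<le> real k"
    using assms by (simp add: field_simps)
  then have "(real k + 1) * exp (- 1 / real k) * exp (- real t / real k)
      \<le> real k * exp (- real t / real k)"
    by (rule mult_right_mono) simp
  moreover have "exp (- 1 / real k) * exp (- real t / real k) = exp (- real (Suc t) / real k)"
    by (simp add: add_divide_distrib diff_divide_distrib flip: exp_add)
  ultimately have "(real k + 1) * exp (- real (Suc t) / real k) \<le> real k * exp (- real t / real k)"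
    by (metis mult.assoc)
  then have "real k * exp (- real (Suc t) / real k) + exp (- real (Suc t) / real k)
      \<le> real k * exp (- real t / real k)"
    by (simp only: distrib_right mult_1)
  then show ?case using Suc.IH unfolding sum.lessThan_Suc[of _ "Suc t"] by linarith
qed simp

text \<open>
  The borders \<open>L\<close> are those of the continuum limit, in which the value function \<open>\<Phi>\<close> has
  \<open>\<Phi> (L j) = c * price P j\<close> and derivative \<open>price P l * exp (x - L l)\<close> on the segment
  \<open>(L (l - 1), L l]\<close>; \<open>marginal\<close> is this derivative, and is written as a minimum over \<open>l\<close> because
  \<open>price P l * exp (- L l)\<close> increases with \<open>l\<close>. A discrete value function is obtained by sampling
  the derivative at the points \<open>(a + s / M) / k\<close>, for a random offset \<open>s\<close>.
\<close>

locale sampled =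
  fixes P :: "real set" and L :: "nat \<Rightarrow> real" and c :: real and k M :: nat
  assumes P: "price_set P" and k: "0 < k" and M: "0 < M" and c: "0 \<le> c" "c \<le> 1"
    and L0: "L 0 = 0" and L1: "L (card P) = 1"
    and L_less: "\<And>j. j \<in> {1..card P} \<Longrightarrow> L (j - 1) < L j"
    and L_price: "\<And>j. j \<in> {1..card P} \<Longrightarrow>
      price P j * exp (L (j - 1) - L j) = price P j - c * (price P j - price P (j - 1))"
begin

definition marginal :: "real \<Rightarrow> real" where
  "marginal x = Min ((\<lambda>l. price P l * exp (x - L l)) ` {l \<in> {1..card P}. x \<le> L l})"

definition point :: "nat \<Rightarrow> nat \<Rightarrow> real" where
  "point s a = real (a * M + s) / real (k * M)"

definition sampled_border :: "nat \<Rightarrow> nat \<Rightarrow> nat" where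
  "sampled_border s j = card {a. a < k \<and> point s a \<le> L j}"

definition sampled_init :: "nat \<Rightarrow> init" where
  "sampled_init s = (\<lambda>j. real (sampled_border s j) / real k,
     \<lambda>y. \<Sum>a | a < k \<and> real a < y * real k. marginal (point s a) / (real k + 1))"

lemma L_mono: "\<lbrakk>i \<le> j; j \<le> card P\<rbrakk> \<Longrightarrow> L i \<le> L j"
proof (induction rule: dec_induct)
  case (step n)
  then show ?case using L_less[of "Suc n"] by simp
qed simp

lemma m: "1 \<le> card P"
  by (rule card_price_set[OF P])

lemma marginal_le:
  assumes "j \<in> {1..card P}" "x \<le> L j"
  shows "marginal x \<le> price P j * exp (x - L j)"
  unfolding marginal_def using assms by (intro Min_le) auto

lemma marginal_in:
  assumes "x \<le> 1"
  obtains l where "l \<in> {1..card P}" "x \<le> L l" "marginal x = price P l * exp (x - L l)"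
proof -
  have "card P \<in> {l \<in> {1..card P}. x \<le> L l}" using m L1 assms by simp
  then have "marginal x \<in> (\<lambda>l. price P l * exp (x - L l)) ` {l \<in> {1..card P}. x \<le> L l}"
    unfolding marginal_def by (intro Min_in) auto
  then show ?thesis using that by auto
qed

lemma marginal_nonneg: "x \<le> 1 \<Longrightarrow> 0 \<le> marginal x"
  by (erule marginal_in) (simp add: price_nonneg[OF P])

lemma price_pred_le:
  assumes "Suc j \<le> card P"
  shows "price P j \<le> price P (Suc j) * exp (L j - L (Suc j))"
proof -
  have "price P j \<le> price P (Suc j)" using price_mono[OF P, of j "Suc j"] assms by simp
  then have "c * (price P (Suc j) - price P j) \<le> price P (Suc j) - price P j"
    using c by (intro mult_left_le_one_le) auto
  then show ?thesis using L_price[of "Suc j"] assms by simp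
qed

lemma discounted_price_mono:
  assumes "i \<le> j" "j \<le> card P"
  shows "price P i * exp (- L i) \<le> price P j * exp (- L j)"
  using assms
proof (induction rule: dec_induct)
  case (step n)
  have "price P n \<le> price P (Suc n) * exp (L n - L (Suc n))"
    using price_pred_le step by simp
  then have "price P n * exp (- L n) \<le> price P (Suc n) * exp (L n - L (Suc n)) * exp (- L n)"
    by (rule mult_right_mono) simp
  also have "\<dots> = price P (Suc n) * exp (- L (Suc n))"
    by (simp add: mult.assoc flip: exp_add)
  finally show ?case using step by simp
qed simp

lemma marginal_ge:
  assumes "j \<in> {1..card P}" "L (j - 1) < x" "x \<le> 1"
  shows "price P j * exp (x - L j) \<le> marginal x"
proof -
  obtain l where l: "l \<in> {1..card P}" "x \<le> L l" "marginal x = price P l * exp (x - L l)"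
    using marginal_in[OF assms(3)] .
  have "j \<le> l"
  proof (rule ccontr)
    assume "\<not> j \<le> l"
    then have "L l \<le> L (j - 1)" using assms(1) by (intro L_mono) auto
    then show False using l(2) assms(2) by simp
  qed
  then have "price P j * exp (- L j) * exp x \<le> price P l * exp (- L l) * exp x"
    using l(1) by (intro mult_right_mono discounted_price_mono) auto
  then show ?thesis by (simp add: l(3) mult.assoc flip: exp_add)
qed

lemma point_mono: "a \<le> b \<Longrightarrow> point s a \<le> point s b"
  by (simp add: point_def divide_right_mono del: of_nat_add of_nat_mult)

lemma point_diff: "a \<le> b \<Longrightarrow> point s b - point s a = real (b - a) / real k"
  using M k by (simp add: point_def field_simps of_nat_diff)

lemma point_le_1:
  assumes "s \<le> M" "a < k"
  shows "point s a \<le> 1"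
proof -
  have "a * M + s \<le> Suc a * M" using assms by simp
  also have "\<dots> \<le> k * M" using assms by (intro mult_right_mono) auto
  finally show ?thesis using k M by (simp add: point_def del: of_nat_add of_nat_mult)
qed

lemma points_below_border: "{a. a < k \<and> point s a \<le> L j} = {..<sampled_border s j}"
  unfolding sampled_border_def
proof (rule down_closed_eq_lessThan)
  show "b \<in> {a. a < k \<and> point s a \<le> L j}" if "a \<in> {a. a < k \<and> point s a \<le> L j}" "b < a" for a b
    using that point_mono[of b a s] by simp
qed simp

lemma sampled_border_le: "sampled_border s j \<le> k"
  using card_mono[of "{..<k}" "{a. a < k \<and> point s a \<le> L j}"]
  by (auto simp: sampled_border_def)

lemma sampled_value:
  assumes "n \<le> k"
  shows "snd (sampled_init s) (real n / real k) = (\<Sum>a<n. marginal (point s a) / (real k + 1))"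
proof -
  have "{a. a < k \<and> real a < real n / real k * real k} = {..<n}" using assms k by auto
  then show ?thesis by (simp add: sampled_init_def)
qed

lemma valid_sampled_init:
  assumes "s \<in> {1..M}"
  shows "valid_init k (card P) (sampled_init s)"
proof -
  have nn: "0 \<le> marginal (point s a)" if "a < k" for a
    using that assms by (intro marginal_nonneg point_le_1) auto
  have "0 < point s a" for a
    using assms k M by (simp add: point_def del: of_nat_add of_nat_mult)
  then have "{a. a < k \<and> point s a \<le> L 0} = {}" using L0 by (auto simp: not_le)
  moreover have "{a. a < k \<and> point s a \<le> L (card P)} = {..<k}"
    using L1 assms by (auto intro: point_le_1)
  moreover have "sampled_border s j \<le> sampled_border s (Suc j)" if "j < card P" for j
    unfolding sampled_border_def using L_mono[of j "Suc j"] that by (intro card_mono) auto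
  ultimately show ?thesis
    using sampled_border_le k sampled_value[of 0 s] sampled_value[of "Suc _" s] sampled_value[of _ s] nn
    unfolding valid_init_def case_prod_unfold
    by (auto simp: divide_right_mono sampled_init_def sampled_border_def)
qed

lemma admissible_sampled_init:
  assumes s: "s \<in> {1..M}"
  shows "admissible_init k P (sampled_init s)"
proof -
  let ?\<Phi> = "snd (sampled_init s)" and ?v = "\<lambda>a. marginal (point s a)"
  have "?\<Phi> (real u / real k) - ?\<Phi> (real a / real k)
      + real k * (?\<Phi> (real (Suc a) / real k) - ?\<Phi> (real a / real k)) \<le> price P j"
    if a: "a < k" and j: "j \<in> {1..card P}" and u: "u = sampled_border s j"
      and less: "?\<Phi> (real a / real k) < ?\<Phi> (real u / real k)" for a j u
  proof -
    have uk: "u \<le> k" unfolding u by (rule sampled_border_le)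
    have au: "a < u"
    proof (rule ccontr)
      assume "\<not> a < u"
      then have "?\<Phi> (real u / real k) \<le> ?\<Phi> (real a / real k)"
        using valid_init_mono[of k "card P" "fst (sampled_init s)" ?\<Phi> u a]
          valid_sampled_init[OF s] a by simp
      then show False using less by simp
    qed
    define t where "t = u - 1 - a"
    have v_le: "?v b \<le> price P j * exp (- real (u - 1 - b) / real k)" if "b < u" for b
    proof -
      have "u - 1 \<in> {a. a < k \<and> point s a \<le> L j}"
        unfolding points_below_border using that u by simp
      then have top: "point s (u - 1) \<le> L j" by blast
      have "?v b \<le> price P j * exp (point s b - L j)"
        using top order_trans[OF point_mono[of b "u - 1" s]] that by (intro marginal_le j) simp
      also have "\<dots> \<le> price P j * exp (- real (u - 1 - b) / real k)"
      proof (intro mult_left_mono price_nonneg[OF P])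
        have "b \<le> u - 1" using that by simp
        from point_diff[OF this, of s] top
        show "exp (point s b - L j) \<le> exp (- real (u - 1 - b) / real k)"
          by (simp del: of_nat_diff)
      qed (use j in auto)
      finally show ?thesis .
    qed
    have "(\<Sum>b = a..<u. ?v b) \<le> (\<Sum>b = a..<u. price P j * exp (- real (u - 1 - b) / real k))"
      by (intro sum_mono v_le) auto
    also have "\<dots> = price P j * (\<Sum>i<Suc t. exp (- real i / real k))"
      unfolding sum_distrib_left
      by (rule sum.reindex_bij_witness[of _ "\<lambda>i. u - 1 - i" "\<lambda>b. u - 1 - b"])
         (use au in \<open>auto simp: t_def\<close>)
    finally have "real k * ?v a + (\<Sum>b = a..<u. ?v b)
        \<le> real k * (price P j * exp (- real t / real k))
          + price P j * (\<Sum>i<Suc t. exp (- real i / real k))"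
      using v_le[OF au] by (intro add_mono mult_left_mono) (auto simp: t_def)
    also have "\<dots> \<le> price P j * (real k + 1)"
      using mult_left_mono[OF exp_decay_sum_le[OF k, of t] price_nonneg[OF P, of j]] j
      by (simp add: algebra_simps)
    finally have le: "real k * ?v a + (\<Sum>b = a..<u. ?v b) \<le> price P j * (real k + 1)" .
    have "?\<Phi> (real u / real k) - ?\<Phi> (real a / real k) = (\<Sum>b = a..<u. ?v b) / (real k + 1)"
      using a uk au
      by (simp add: sampled_value sum_divide_distrib lessThan_atLeast0 sum_diff_nat_ivl)
    moreover have "?\<Phi> (real (Suc a) / real k) - ?\<Phi> (real a / real k) = ?v a / (real k + 1)"
      using a by (simp only: sampled_value Suc_leI less_imp_le) simp
    ultimately have "?\<Phi> (real u / real k) - ?\<Phi> (real a / real k)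
        + real k * (?\<Phi> (real (Suc a) / real k) - ?\<Phi> (real a / real k))
      = (real k * ?v a + (\<Sum>b = a..<u. ?v b)) / (real k + 1)"
      by (simp add: add_divide_distrib)
    also have "\<dots> \<le> price P j" using le by (simp add: pos_divide_le_eq)
    finally show ?thesis .
  qed
  moreover have "fst (sampled_init s) j = real (sampled_border s j) / real k" for j
    by (simp add: sampled_init_def)
  ultimately show ?thesis
    using valid_sampled_init[OF s] by (auto simp: admissible_init_def case_prod_unfold)
qed

lemma expected_sampled_border_value:
  "measure_pmf.expectation (map_pmf sampled_init (pmf_of_set {1..M})) (\<lambda>(B, \<Phi>). \<Phi> (B j))
    = (\<Sum>n | n \<in> {1..k * M} \<and> real n / real (k * M) \<le> L j. marginal (real n / real (k * M)))
      / (real M * (real k + 1))"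
proof -
  let ?f = "\<lambda>n. if real n / real (k * M) \<le> L j then marginal (real n / real (k * M)) else 0"
  have "measure_pmf.expectation (map_pmf sampled_init (pmf_of_set {1..M})) (\<lambda>(B, \<Phi>). \<Phi> (B j))
      = (\<Sum>s = 1..M. snd (sampled_init s) (real (sampled_border s j) / real k)) / real M"
    using M by (simp add: integral_pmf_of_set case_prod_unfold sampled_init_def)
  also have "\<dots> = (\<Sum>s = 1..M. (\<Sum>a<k. ?f (a * M + s)) / (real k + 1)) / real M"
  proof (intro arg_cong2[where f = "(/)"] sum.cong refl)
    fix s
    have "snd (sampled_init s) (real (sampled_border s j) / real k)
        = (\<Sum>a | a < k \<and> point s a \<le> L j. marginal (point s a)) / (real k + 1)"
      by (simp add: sampled_value sampled_border_le points_below_border sum_divide_distrib)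
    also have "(\<Sum>a | a < k \<and> point s a \<le> L j. marginal (point s a))
        = (\<Sum>a<k. if point s a \<le> L j then marginal (point s a) else 0)"
      by (subst sum.inter_filter[symmetric]) auto
    finally show "snd (sampled_init s) (real (sampled_border s j) / real k)
        = (\<Sum>a<k. ?f (a * M + s)) / (real k + 1)"
      by (simp only: point_def)
  qed
  also have "\<dots> = sum ?f {1..k * M} / (real M * (real k + 1))"
    unfolding sum_blocks[symmetric] sum_divide_distrib[symmetric]
    by (simp only: divide_divide_eq_left mult.commute[of "real M"])
  also have "sum ?f {1..k * M} = (\<Sum>n | n \<in> {1..k * M} \<and> real n / real (k * M) \<le> L j.
      marginal (real n / real (k * M)))"
    by (subst sum.inter_filter) auto
  finally show ?thesis .
qed

lemma exp_sum_ge: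
  fixes h :: real
  assumes "0 \<le> h" "i \<le> n"
  shows "exp (real n * h) - exp (real i * h) \<le> h * (\<Sum>l = i + 1..n. exp (real l * h))"
  using assms(2)
proof (induction rule: dec_induct)
  case (step n)
  have "1 - exp (- h) \<le> h" using exp_ge_add_one_self[of "- h"] by simp
  then have "(1 - exp (- h)) * exp (real (Suc n) * h) \<le> h * exp (real (Suc n) * h)"
    by (rule mult_right_mono) simp
  moreover have "exp (- h) * exp (real (Suc n) * h) = exp (real n * h)"
    by (simp add: algebra_simps flip: exp_add)
  ultimately show ?case using step by (simp add: algebra_simps)
qed simp

text \<open>
  The Riemann sum of \<open>marginal\<close> up to \<open>L j\<close>. The defect \<open>1 - exp (n / (k * M) - L j)\<close> of the last,
  incomplete, step is kept exact, so that it telescopes between consecutive segments.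
\<close>

lemma marginal_sum_ge:
  assumes "j \<le> card P"
  defines "K \<equiv> real (k * M)"
  defines "n \<equiv> \<lambda>j. nat \<lfloor>L j * K\<rfloor>"
  shows "(c - (1 - exp (real (n j) / K - L j))) * price P j
    \<le> (\<Sum>i = 1..n j. marginal (real i / K)) / K"
  using assms(1)
proof (induction j)
  case 0
  show ?case by (simp add: price_props(1)[OF P] n_def L0)
next
  case (Suc j)
  have K: "0 < K" using k M by (simp add: K_def)
  let ?e = "\<lambda>j. exp (real (n j) / K - L j)" and ?r = "price P"
  have Lj: "0 \<le> L j" "L j \<le> L (Suc j)" "L (Suc j) \<le> 1"
    using L_mono[of 0 j] L_mono[of j "Suc j"] L_mono[of "Suc j" "card P"] Suc.prems L0 L1 by auto
  have n_le: "n j \<le> n (Suc j)" using Lj K by (auto simp: n_def intro!: nat_mono floor_mono)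
  have n_up: "real (n i) / K \<le> L i" if "0 \<le> L i" for i
    using that K by (simp add: n_def field_simps)
  have n_lo: "L j < real i / K" if "n j < i" for i
    using that Lj(1) K by (simp add: n_def field_simps nat_less_iff floor_less_iff)
  have e1: "?e j \<le> 1" using n_up[of j] Lj by simp
  have jm: "Suc j \<in> {1..card P}" using Suc.prems by simp
  have r0: "0 \<le> ?r (Suc j)" using price_nonneg[OF P Suc.prems] .
  have r_step: "?r (Suc j) * exp (L j - L (Suc j)) = ?r (Suc j) - c * (?r (Suc j) - ?r j)"
    using L_price[OF jm] by simp
  have rj: "?r j \<le> ?r (Suc j) * exp (L j - L (Suc j))"
    by (rule price_pred_le[OF Suc.prems])
  have "?r (Suc j) * (?e (Suc j) - exp (L j - L (Suc j)) * ?e j)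
      = ?r (Suc j) * exp (- L (Suc j)) * (exp (real (n (Suc j)) * (1 / K)) - exp (real (n j) * (1 / K)))"
    by (simp add: algebra_simps flip: exp_add)
  also have "\<dots> \<le> ?r (Suc j) * exp (- L (Suc j)) *
      (1 / K * (\<Sum>i = n j + 1..n (Suc j). exp (real i * (1 / K))))"
    using r0 K by (intro mult_left_mono exp_sum_ge n_le) auto
  also have "\<dots> = (\<Sum>i = n j + 1..n (Suc j). ?r (Suc j) * exp (real i / K - L (Suc j))) / K"
    unfolding sum_distrib_left sum_divide_distrib
    by (intro sum.cong refl) (simp add: exp_diff exp_minus divide_inverse)
  also have "\<dots> \<le> (\<Sum>i = n j + 1..n (Suc j). marginal (real i / K)) / K"
  proof (intro divide_right_mono sum_mono marginal_ge jm)
    fix i assume i: "i \<in> {n j + 1..n (Suc j)}"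
    show "L (Suc j - 1) < real i / K" using n_lo[of i] i by simp
    have "real i / K \<le> real (n (Suc j)) / K" using i K by (simp add: divide_right_mono)
    then show "real i / K \<le> 1" using n_up[of "Suc j"] Lj by simp
  qed (use K in simp)
  finally have seg: "?r (Suc j) * (?e (Suc j) - exp (L j - L (Suc j)) * ?e j)
      \<le> (\<Sum>i = n j + 1..n (Suc j). marginal (real i / K)) / K" .
  have "(c - (1 - ?e (Suc j))) * ?r (Suc j)
      = (c - (1 - ?e j)) * ?r j + ?r (Suc j) * (?e (Suc j) - exp (L j - L (Suc j)) * ?e j)
        + (?r j - ?r (Suc j) * exp (L j - L (Suc j))) * (1 - ?e j)"
    using r_step by (simp add: algebra_simps)
  also have "\<dots> \<le> (c - (1 - ?e j)) * ?r j + ?r (Suc j) * (?e (Suc j) - exp (L j - L (Suc j)) * ?e j)"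
    using rj e1 by (simp add: mult_nonpos_nonneg)
  also have "\<dots> \<le> (\<Sum>i = 1..n j. marginal (real i / K)) / K
      + (\<Sum>i = n j + 1..n (Suc j). marginal (real i / K)) / K"
    using Suc.IH Suc.prems seg by (intro add_mono) auto
  also have "\<dots> = (\<Sum>i = 1..n (Suc j). marginal (real i / K)) / K"
    using sum.ub_add_nat[of 1 "n j" "\<lambda>i. marginal (real i / K)" "n (Suc j) - n j"] n_le
    by (simp add: add_divide_distrib)
  finally show ?case .
qed

lemma expected_sampled_border_value_ge:
  assumes j: "j \<in> {1..card P}"
  shows "real k * (c - 1 / real (k * M)) / (real k + 1) * price P j
    \<le> measure_pmf.expectation (map_pmf sampled_init (pmf_of_set {1..M})) (\<lambda>(B, \<Phi>). \<Phi> (B j))"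
proof -
  let ?K = "real (k * M)" and ?n = "nat \<lfloor>L j * real (k * M)\<rfloor>"
  have K: "0 < ?K" using k M by simp
  have Lj: "0 \<le> L j" "L j \<le> 1"
    using L_mono[of 0 j] L_mono[of j "card P"] j L0 L1 by auto
  have points: "{n. n \<in> {1..k * M} \<and> real n / ?K \<le> L j} = {1..?n}"
  proof -
    have le: "n \<le> ?n \<longleftrightarrow> real n / ?K \<le> L j" for n
      using Lj K by (simp add: le_nat_floor pos_divide_le_eq le_nat_iff le_floor_iff)
    have "?n \<le> k * M"
    proof -
      have "real ?n \<le> L j * ?K" using Lj by simp
      also have "\<dots> \<le> 1 * ?K" using Lj by (intro mult_right_mono) auto
      finally show ?thesis by (simp del: of_nat_mult)
    qed
    then show ?thesis
      unfolding le[symmetric] set_eq_iff mem_Collect_eq atLeastAtMost_iff by (meson order_trans)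
  qed
  have "z / (real M * (real k + 1)) = real k / (real k + 1) * (z / ?K)" for z :: real
    using k M by (simp add: field_simps)
  then have E: "measure_pmf.expectation (map_pmf sampled_init (pmf_of_set {1..M})) (\<lambda>(B, \<Phi>). \<Phi> (B j))
      = real k / (real k + 1) * ((\<Sum>i = 1..?n. marginal (real i / ?K)) / ?K)"
    unfolding expected_sampled_border_value points .
  have "- (1 / ?K) \<le> real ?n / ?K - L j"
  proof -
    have "L j * ?K - 1 \<le> real ?n" using Lj by linarith
    then have "(L j * ?K - 1) / ?K \<le> real ?n / ?K"
      using K by (intro divide_right_mono) auto
    then show ?thesis using k M by (simp add: diff_divide_distrib)
  qed
  then have "1 - exp (real ?n / ?K - L j) \<le> 1 / ?K"
    using exp_ge_add_one_self[of "real ?n / ?K - L j"] by linarith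
  then have "(c - 1 / ?K) * price P j \<le> (c - (1 - exp (real ?n / ?K - L j))) * price P j"
    using j by (intro mult_right_mono price_nonneg[OF P]) auto
  also have "\<dots> \<le> (\<Sum>i = 1..?n. marginal (real i / ?K)) / ?K"
    using j by (intro marginal_sum_ge) auto
  finally have "real k / (real k + 1) * ((c - 1 / ?K) * price P j)
      \<le> real k / (real k + 1) * ((\<Sum>i = 1..?n. marginal (real i / ?K)) / ?K)"
    by (rule mult_left_mono) simp
  then show ?thesis unfolding E by (simp add: mult.assoc)
qed

end

lemma price_eq_alphas:
  assumes P: "price_set P" and j: "j \<in> {1..card P}"
  shows "price P j * exp (- alphas P j) = price P j - F_val P * (price P j - price P (j - 1))"
proof -
  have "1 - exp (- alphas P j) = F_val P * price_weight P j"
  proof (cases "j = 1")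
    case True
    then show ?thesis by (simp add: F_val_def price_weight_def price_props(1)[OF P])
  next
    case False
    have "F_val P = (1 - exp (- alphas P j)) / price_weight P j"
      using alphas_alpha_system[OF P] j False
      by (auto simp: alpha_system_def F_val_def price_weight_def)
    then show ?thesis using price_weight_props(2)[OF P j] by (simp add: field_simps)
  qed
  then have "price P j * exp (- alphas P j) = price P j * (1 - F_val P * price_weight P j)"
    by simp
  also have "\<dots> = price P j - F_val P * (price P j * price_weight P j)"
    by (simp add: algebra_simps)
  also have "price P j * price_weight P j = price P j - price P (j - 1)"
    using price_props(2)[OF P j] by (simp add: price_weight_def right_diff_distrib)
  finally show ?thesis .
qed

lemma alphas_pos: "\<lbrakk>price_set P; j \<in> {1..card P}\<rbrakk> \<Longrightarrow> 0 < alphas P j"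
  using alphas_alpha_system[of P] unfolding alpha_system_def by blast

lemma F_val_bounds:
  assumes "price_set P"
  shows "0 < F_val P" "F_val P \<le> 1"
  using alphas_pos[OF assms, of 1] card_price_set[OF assms] by (auto simp: F_val_def)

lemma G_val_pos: "price_set P \<Longrightarrow> 0 < G_val P"
  using sigmas_sigma_system[of P] card_price_set[of P]
  by (auto simp: G_val_def sigma_system_def)

lemma sampled_alphas:
  assumes P: "price_set P" and "0 < k" "0 < M"
  shows "sampled P (\<lambda>j. \<Sum>i = 1..j. alphas P i) (F_val P) k M"
proof
  show "price_set P" "0 < k" "0 < M" by (rule assms)+
  show "0 \<le> F_val P" "F_val P \<le> 1" using F_val_bounds[OF P] by auto
  show "(\<Sum>i = 1..card P. alphas P i) = 1"
    using alphas_alpha_system[OF P] by (simp add: alpha_system_def)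
  fix j assume j: "j \<in> {1..card P}"
  then have eq: "(\<Sum>i = 1..j. alphas P i) = (\<Sum>i = 1..j - 1. alphas P i) + alphas P j"
    by (cases j) auto
  show "(\<Sum>i = 1..j - 1. alphas P i) < (\<Sum>i = 1..j. alphas P i)"
    unfolding eq using alphas_pos[OF P j] by simp
  show "price P j * exp ((\<Sum>i = 1..j - 1. alphas P i) - (\<Sum>i = 1..j. alphas P i)) =
      price P j - F_val P * (price P j - price P (j - 1))"
    unfolding eq using price_eq_alphas[OF P j] by simp
qed simp

lemma multi_unit_init:
  assumes P: "price_set P" and k: "0 < k"
  obtains D where "finite (set_pmf D)"
    "\<And>\<omega>. \<omega> \<in> set_pmf D \<Longrightarrow> admissible_init k P \<omega>"
    "\<And>j. j \<in> {1..card P} \<Longrightarrow>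
      F_val P / ((1 + real k) * (exp (1 / real k) - 1)) * price P j
        \<le> measure_pmf.expectation D (\<lambda>(L, \<Phi>). \<Phi> (L j))"
proof -
  define c where "c = F_val P"
  have c: "0 < c" unfolding c_def by (rule F_val_bounds[OF P])
  define E where "E = exp (1 / real k) - 1"
  have "1 / real k < 1 / real k + (1 / real k)\<^sup>2 / 2" using k by simp
  also have "\<dots> \<le> E" using exp_lower_Taylor_quadratic[of "1 / real k"] by (simp add: E_def)
  finally have E: "1 / real k < E" .
  then have E0: "0 < E" using k by (meson less_trans of_nat_0_less_iff zero_less_divide_1_iff)
  have "0 < c * (real k - 1 / E)"
    using c k E E0 by (simp add: field_simps)
  then obtain n where n: "inverse (real (Suc n)) < c * (real k - 1 / E)"
    using reals_Archimedean by blast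
  interpret sampled P "\<lambda>j. \<Sum>i = 1..j. alphas P i" c k "Suc n"
    unfolding c_def by (rule sampled_alphas[OF P k]) simp
  let ?D = "map_pmf sampled_init (pmf_of_set {1..Suc n})"
  have "c / E \<le> real k * (c - 1 / real (k * Suc n))"
  proof -
    have "real k * (c - 1 / real (k * Suc n)) = real k * c - inverse (real (Suc n))"
      using k by (simp add: right_diff_distrib inverse_eq_divide del: of_nat_Suc mult_Suc_right)
    then show ?thesis using n by (simp add: right_diff_distrib mult.commute del: of_nat_Suc)
  qed
  then have "c / E / (real k + 1) \<le> real k * (c - 1 / real (k * Suc n)) / (real k + 1)"
    by (rule divide_right_mono) simp
  moreover have "c / E / (real k + 1) = F_val P / ((1 + real k) * (exp (1 / real k) - 1))"
    by (simp add: c_def E_def mult.commute add.commute)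
  ultimately have bound: "F_val P / ((1 + real k) * (exp (1 / real k) - 1))
      \<le> real k * (c - 1 / real (k * Suc n)) / (real k + 1)"
    by linarith
  show ?thesis
  proof
    have set: "set_pmf (pmf_of_set {1..Suc n}) = {1..Suc n}" by (intro set_pmf_of_set) auto
    then show "finite (set_pmf ?D)" by simp
    show "admissible_init k P \<omega>" if "\<omega> \<in> set_pmf ?D" for \<omega>
      using that admissible_sampled_init unfolding set_map_pmf set by blast
    show "F_val P / ((1 + real k) * (exp (1 / real k) - 1)) * price P j
        \<le> measure_pmf.expectation ?D (\<lambda>(L, \<Phi>). \<Phi> (L j))" if "j \<in> {1..card P}" for j
      using mult_right_mono[OF bound price_nonneg[OF P, of j]] that
        expected_sampled_border_value_ge[OF that] by auto
  qed
qed

lemma exp_geometric_sum: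
  assumes "0 < k"
  shows "(\<Sum>n = 1..k. exp (real n / real k - 1)) = (1 - 1 / exp 1) / (1 - exp (- 1 / real k))"
proof -
  have "(1 - exp (- 1 / real k)) * (\<Sum>n = 1..i. exp (real n / real k - 1))
      = exp (real i / real k - 1) - exp (- 1)" for i
  proof (induction i)
    case (Suc i)
    have "exp (- 1 / real k) * exp (real (Suc i) / real k - 1) = exp (real i / real k - 1)"
      by (simp add: add_divide_distrib flip: exp_add)
    then show ?case using Suc by (simp add: algebra_simps)
  qed simp
  from this[of k] have "(1 - exp (- 1 / real k)) * (\<Sum>n = 1..k. exp (real n / real k - 1))
      = 1 - 1 / exp 1"
    using assms by (simp add: exp_minus inverse_eq_divide)
  then show ?thesis using assms by (simp add: field_simps)
qed

text \<open>With a single price the offset need not be randomized.\<close>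

lemma single_price_init:
  assumes P: "price_set P" and card: "card P = 1" and k: "0 < k"
  obtains D where "finite (set_pmf D)"
    "\<And>\<omega>. \<omega> \<in> set_pmf D \<Longrightarrow> admissible_init k P \<omega>"
    "\<And>j. j \<in> {1..card P} \<Longrightarrow>
      (1 - 1 / exp 1) / ((1 + real k) * (1 - exp (- 1 / real k))) * price P j
        \<le> measure_pmf.expectation D (\<lambda>(L, \<Phi>). \<Phi> (L j))"
proof -
  let ?L = "\<lambda>j. \<Sum>i = 1..j. alphas P i"
  interpret sampled P ?L "F_val P" k 1
    by (rule sampled_alphas[OF P k]) simp
  have L_1: "?L 1 = 1" using L1 card by simp
  let ?D = "map_pmf sampled_init (pmf_of_set {1..1::nat})"
  show ?thesis
  proof
    show "finite (set_pmf ?D)" by simp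
    show "admissible_init k P \<omega>" if "\<omega> \<in> set_pmf ?D" for \<omega>
      using that admissible_sampled_init[of 1] by (simp add: set_pmf_of_set)
    fix j assume "j \<in> {1..card P}"
    then have j: "j = 1" using card by simp
    have "(1 - 1 / exp 1) / ((1 + real k) * (1 - exp (- 1 / real k))) * price P j
        = (\<Sum>n = 1..k. price P 1 * exp (real n / real k - 1)) / (real k + 1)"
      using exp_geometric_sum[OF k] by (simp add: j sum_distrib_left[symmetric] mult_ac add_ac)
    also have "\<dots> \<le> (\<Sum>n = 1..k. marginal (real n / real k)) / (real k + 1)"
    proof (intro divide_right_mono sum_mono)
      fix n assume "n \<in> {1..k}"
      then have "?L (1 - 1) < real n / real k" "real n / real k \<le> 1" by auto
      from marginal_ge[OF _ this] show "price P 1 * exp (real n / real k - 1) \<le> marginal (real n / real k)"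
        using card L_1 by simp
    qed simp
    also have "\<dots> = (\<Sum>n | n \<in> {1..k * 1} \<and> real n / real (k * 1) \<le> ?L j. marginal (real n / real (k * 1)))
        / (real 1 * (real k + 1))"
    proof -
      have "{n. n \<in> {1..k * 1} \<and> real n / real (k * 1) \<le> ?L j} = {1..k}"
        using k unfolding j L_1 by auto
      then show ?thesis by simp
    qed
    also have "\<dots> = measure_pmf.expectation ?D (\<lambda>(L, \<Phi>). \<Phi> (L j))"
      by (rule expected_sampled_border_value[symmetric])
    finally show "(1 - 1 / exp 1) / ((1 + real k) * (1 - exp (- 1 / real k))) * price P j
        \<le> measure_pmf.expectation ?D (\<lambda>(L, \<Phi>). \<Phi> (L j))" .
  qed
qed

lemma single_price_ratio_bounds:
  assumes P: "price_set P" "card P = 1" and k: "0 < k"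
  defines "c \<equiv> (1 - 1 / exp 1) / ((1 + real k) * (1 - exp (- 1 / real k)))"
  shows "F_val P / ((1 + real k) * (exp (1 / real k) - 1)) \<le> c" "G_val P / 2 \<le> c"
proof -
  have "alphas P 1 = 1" using alphas_alpha_system[OF P(1)] P(2) by (simp add: alpha_system_def)
  then have F: "F_val P = 1 - 1 / exp 1" by (simp add: F_val_def exp_minus inverse_eq_divide)
  have G: "G_val P = 1" using sigmas_sigma_system[OF P(1)] P(2) by (simp add: sigma_system_def G_val_def)
  have pos: "0 < 1 - exp (- 1 / real k)" using k by simp
  have "1 - exp (- 1 / real k) \<le> exp (1 / real k) - 1"
  proof -
    have "exp (1 / real k) - 1 = exp (1 / real k) * (1 - exp (- 1 / real k))"
      by (simp add: right_diff_distrib flip: exp_add)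
    moreover have "1 * (1 - exp (- 1 / real k)) \<le> exp (1 / real k) * (1 - exp (- 1 / real k))"
      using pos by (intro mult_right_mono) auto
    ultimately show ?thesis by simp
  qed
  then show "F_val P / ((1 + real k) * (exp (1 / real k) - 1)) \<le> c"
    unfolding F c_def using pos k by (intro divide_left_mono mult_left_mono mult_pos_pos) auto
  have "(real k + 1) / 2 = (\<Sum>n = 1..k. real n / real k)"
  proof -
    have "(\<Sum>n = 1..k. real n) = real k * (real k + 1) / 2"
      by (induction k) (auto simp: field_simps)
    then show ?thesis using k by (simp flip: sum_divide_distrib)
  qed
  also have "\<dots> \<le> (\<Sum>n = 1..k. exp (real n / real k - 1))"
  proof (rule sum_mono)
    fix n show "real n / real k \<le> exp (real n / real k - 1)"
      using exp_ge_add_one_self[of "real n / real k - 1"] by simp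
  qed
  also have "\<dots> = c * (real k + 1)"
  proof -
    have "z / y = z / y / (1 + real k) * (1 + real k)" for y z :: real
      by simp
    then have "z / y = z / ((1 + real k) * y) * (real k + 1)" for y z :: real
      by (simp add: mult.commute add.commute)
    then show ?thesis unfolding exp_geometric_sum[OF k] c_def .
  qed
  finally have "1 / 2 * (real k + 1) \<le> c * (real k + 1)" by simp
  then show "G_val P / 2 \<le> c" unfolding G by (rule mult_right_le_imp_le) simp
qed

definition init_guarantee :: "nat \<Rightarrow> real set \<Rightarrow> bool \<Rightarrow> init pmf \<Rightarrow> real \<Rightarrow> bool" where
  "init_guarantee k P split D f \<longleftrightarrow> finite (set_pmf D) \<and>
    (\<forall>\<omega>\<in>set_pmf D. admissible_init (if split then 1 else k) P \<omega>) \<and>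
    (\<forall>j\<in>{1..card P}. f * price P j \<le> measure_pmf.expectation D (\<lambda>(L, \<Phi>). \<Phi> (L j))) \<and>
    F_val P / ((1 + real k) * (exp (1 / real k) - 1)) \<le> f \<and> G_val P / 2 \<le> f \<and>
    (card P = 1 \<longrightarrow> (1 - 1 / exp 1) / ((1 + real k) * (1 - exp (- 1 / real k))) \<le> f)"

lemma init_guarantee_exists:
  assumes P: "price_set P" and k: "0 < k"
  shows "\<exists>split D f. init_guarantee k P split D f"
proof (cases "card P = 1")
  case True
  obtain D where "finite (set_pmf D)" "\<And>\<omega>. \<omega> \<in> set_pmf D \<Longrightarrow> admissible_init k P \<omega>"
    "\<And>j. j \<in> {1..card P} \<Longrightarrow>
      (1 - 1 / exp 1) / ((1 + real k) * (1 - exp (- 1 / real k))) * price P j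
        \<le> measure_pmf.expectation D (\<lambda>(L, \<Phi>). \<Phi> (L j))"
    using single_price_init[OF P True k] by metis
  then have "init_guarantee k P False D ((1 - 1 / exp 1) / ((1 + real k) * (1 - exp (- 1 / real k))))"
    using single_price_ratio_bounds[OF P True k] by (simp add: init_guarantee_def)
  then show ?thesis by blast
next
  case False
  show ?thesis
  proof (cases "F_val P / ((1 + real k) * (exp (1 / real k) - 1)) \<le> G_val P / 2")
    case True
    obtain D where "finite (set_pmf D)" "\<And>\<omega>. \<omega> \<in> set_pmf D \<Longrightarrow> admissible_init 1 P \<omega>"
      "\<And>j. j \<in> {1..card P} \<Longrightarrow>
        G_val P / 2 * price P j \<le> measure_pmf.expectation D (\<lambda>(L, \<Phi>). \<Phi> (L j))"
      using single_unit_init[OF P] by metis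
    then have "init_guarantee k P True D (G_val P / 2)" using True False by (simp add: init_guarantee_def)
    then show ?thesis by blast
  next
    case ge: False
    obtain D where "finite (set_pmf D)" "\<And>\<omega>. \<omega> \<in> set_pmf D \<Longrightarrow> admissible_init k P \<omega>"
      "\<And>j. j \<in> {1..card P} \<Longrightarrow>
        F_val P / ((1 + real k) * (exp (1 / real k) - 1)) * price P j
          \<le> measure_pmf.expectation D (\<lambda>(L, \<Phi>). \<Phi> (L j))"
      using multi_unit_init[OF P k] by metis
    then have "init_guarantee k P False D (F_val P / ((1 + real k) * (exp (1 / real k) - 1)))"
      using ge False by (simp add: init_guarantee_def)
    then show ?thesis by blast
  qed
qed

theorem theorem1:
  fixes S :: "'i sales_setup"
  assumes "valid_setup S"
  shows "\<exists>(Q :: 'i set) (D :: 'i \<times> nat \<Rightarrow> init pmf) (Ft :: 'i \<Rightarrow> real).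
    Q \<subseteq> items S \<and> init_procedures (split_setup Q S) D \<and>
    (\<forall>d. MPB_rule (split_setup Q S) d \<longrightarrow>
       achieves_competitive_ratio S
         (\<lambda>A. MPB_revenue (split_setup Q S) D d (map split_customer A))
         (MIN i\<in>items S. Ft i)) \<and>
    (\<forall>i\<in>items S.
       Ft i \<ge> F_val (prices S i) / ((1 + real (inv_of S i)) * (exp (1 / real (inv_of S i)) - 1)) \<and>
       Ft i \<ge> G_val (prices S i) / 2 \<and>
       (card (prices S i) = 1 \<longrightarrow>
          Ft i \<ge> (1 - 1 / exp 1) /
            ((1 + real (inv_of S i)) * (1 - exp (- 1 / real (inv_of S i))))))"
proof -
  let ?k = "inv_of S" and ?P = "prices S"
  have fin: "finite (items S)" and ne: "items S \<noteq> {}"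
    using assms by (auto simp: valid_setup_def)
  have item: "price_set (?P i)" "0 < ?k i" if "i \<in> items S" for i
    using assms that by (auto simp: valid_setup_def Suc_le_eq)
  have "\<exists>split D f. init_guarantee (?k i) (?P i) split D f" if "i \<in> items S" for i
    using init_guarantee_exists item that by blast
  then obtain split D Ft where init: "\<And>i. i \<in> items S \<Longrightarrow>
      init_guarantee (?k i) (?P i) (split i) (D i) (Ft i)"
    by metis
  define Q where "Q = {i \<in> items S. split i}"
  have adm: "admissible_init (if i \<in> Q then 1 else ?k i) (?P i) \<omega>"
    if "i \<in> items S" "\<omega> \<in> set_pmf (D i)" for i \<omega>
    using init[OF that(1)] that by (simp add: Q_def init_guarantee_def)
  have "init_procedures (split_setup Q S) (\<lambda>(i, l). D i)"
    unfolding init_procedures_def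
  proof (intro ballI)
    fix il \<omega> assume il: "il \<in> items (split_setup Q S)" "\<omega> \<in> set_pmf (case il of (i, l) \<Rightarrow> D i)"
    then have "fst il \<in> items S" "\<omega> \<in> set_pmf (D (fst il))"
      by (auto simp: split_setup_sel)
    from adm[OF this]
    show "valid_init (inv_of (split_setup Q S) il) (card (prices (split_setup Q S) il)) \<omega>"
      by (cases \<omega>) (simp add: split_setup_sel admissible_init_def split: if_splits)
  qed
  moreover have "0 \<le> Ft i" if "i \<in> items S" for i
    using init[OF that] G_val_pos[OF item(1)[OF that]] unfolding init_guarantee_def by linarith
  then have "0 \<le> (MIN i\<in>items S. Ft i)" using fin ne by simp
  then have "achieves_competitive_ratio S
      (\<lambda>A. MPB_revenue (split_setup Q S) (\<lambda>(i, l). D i) d (map split_customer A))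
      (MIN i\<in>items S. Ft i)" if "MPB_rule (split_setup Q S) d" for d
    using fin init adm that
    by (intro split_MPB_competitive[where c = Ft] assms) (auto simp: init_guarantee_def)
  ultimately show ?thesis
    using init
    by (intro exI[of _ Q] exI[of _ "\<lambda>(i, l). D i"] exI[of _ Ft])
       (auto simp: Q_def init_guarantee_def)
qed

end
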